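(* Let $T=\{0,1/2,1/3,\ldots,1/n,\ldots\}$. Let $\{\lambda_j\}_{j\ge 2}$, $\{f_j\}_{j\ge 2}$, $\{g_j\}_{j\ge 2}$ be real sequences with $\lambda_j>0$, $0<f_j<1$, $0<g_j<1$ for all $j\ge 2$, $\lim_{n\to\infty}\lambda_n=0$, and $$\sum_{j=2}^{\infty}\frac{1-f_j}{\lambda_j}<1,\qquad \sum_{j=2}^{\infty}\frac{1-g_j}{\lambda_j}<1 .$$ Let $U$ be the kernel on $T$ defined by $U(0,0)=2$, $U(0,1/j)=1+g_j$, $U(1/i,0)=1+f_i$ and $U(1/i,1/j)=\lambda_i\delta_{i,j}+1+f_ig_j$ for $i,j\ge 2$. For $\alpha>0$ let $X_{(\alpha)}=\{X_{(\alpha),s},\,s\in T\}$ be an $\alpha$-permanental sequence with kernel $U$. If $$\lim_{n\to\infty}\lambda_n\log n=\infty,$$ then for all $\alpha>0$, $$\limsup_{n\to\infty}\frac{X_{(\alpha),1/n}}{\lambda_n\log n}=1\qquad\text{almost surely}.$$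
   Context: An $\alpha$-permanental vector with kernel $K$ (an $n\times n$ matrix), $\alpha>0$, is a random vector $(X_1,\ldots,X_n)$ with values in $[0,\infty)^n$ such that for every diagonal matrix $S$ with non-negative diagonal entries $s_1,\ldots,s_n$, $$E\Big(e^{-\sum_{i=1}^n s_iX_i}\Big)=\frac{1}{|I+KS|^{\alpha}},$$ where $|\cdot|$ denotes the determinant. An $\alpha$-permanental process (sequence) on $T$ with kernel $\{K(s,t);s,t\in T\}$ is a stochastic process $\{X_t,t\in T\}$ such that for all distinct $t_1,\ldots,t_n\in T$, $(X_{t_1},\ldots,X_{t_n})$ is an $\alpha$-permanental vector with kernel $\{K(t_i,t_j)\}_{i,j=1}^n$. For the kernel $U$ of the claim, such a sequence exists for every $\alpha>0$. *)

theory Defs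
  imports "HOL-Probability.Probability" "Jordan_Normal_Form.Determinant"
begin

context prob_space
begin

text \<open>
  Vectors of length \<open>n\<close> are indexed by \<open>0, \<dots>, n - 1\<close>; values at indices \<open>i \<ge> n\<close> are
  irrelevant. The Laplace transform equation forces the determinant to be positive: it equals 1 at
  \<open>s = 0\<close> and is continuous in \<open>s\<close>, and it cannot vanish because the left-hand side is positive,
  whereas \<open>1 / 0 powr \<alpha> = 0\<close>. So \<open>powr\<close> is only ever used with a positive base.
\<close>

definition permanental_vector :: "real \<Rightarrow> nat \<Rightarrow> real mat \<Rightarrow> (nat \<Rightarrow> 'a \<Rightarrow> real) \<Rightarrow> bool" where
  "permanental_vector \<alpha> n K X \<longleftrightarrow>
     \<alpha> > 0 \<and> K \<in> carrier_mat n n \<and>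
     (\<forall>i<n. random_variable borel (X i) \<and> (\<forall>\<omega>\<in>space M. 0 \<le> X i \<omega>)) \<and>
     (\<forall>s. (\<forall>i<n. 0 \<le> s i) \<longrightarrow>
        expectation (\<lambda>\<omega>. exp (- (\<Sum>i<n. s i * X i \<omega>))) =
        1 / Determinant.det (1\<^sub>m n + K * mat_diag n s) powr \<alpha>)"

definition permanental_process ::
    "real \<Rightarrow> 't set \<Rightarrow> ('t \<Rightarrow> 't \<Rightarrow> real) \<Rightarrow> ('t \<Rightarrow> 'a \<Rightarrow> real) \<Rightarrow> bool" where
  "permanental_process \<alpha> T K X \<longleftrightarrow>
     (\<forall>n t. inj_on t {..<n} \<and> t ` {..<n} \<subseteq> T \<longrightarrow>
        permanental_vector \<alpha> n (Matrix.mat n n (\<lambda>(i, j). K (t i) (t j))) (\<lambda>i. X (t i)))"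

end

end

(*
  Write v_i = 1 / (1 + l_i s_i). The determinant |I + US| restricted to the indices 1/i factors as
  prod (1 + l_i s_i) * Q(v), where Q is the determinant of a 2 x 2 matrix that is affine in v,
  because U is a diagonal matrix plus a matrix of rank two.

  Lower bound. Far out in the sequence Q(v) = Q(0) * det (I - P(v)) with P(v) entrywise nonnegative
  and linear in v, so Q^(-alpha) is a power series in v with nonnegative coefficients. By uniqueness
  of Laplace transforms the vector (X_{1/i}) is then a mixture of vectors with independent
  Gamma(alpha + k_i) components of scale l_i, k_i >= 0, hence is stochastically larger than a vector
  of independent Gamma(alpha) variables of scale l_i, and P(X_{1/i} <= x_i for all i) is at most the
  product of the corresponding Gamma probabilities.

  Upper bound. Under the weight exp (- s0 X_0) the variable X_{1/n} is a multiple of a Gamma(alpha)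
  variable with scale l_n + (1 + f_n g_n + s0 (1 - f_n)(1 - g_n)) / (1 + 2 s0). For
  s0 = 1 / (delta l_n) this scale is (1 + O(delta)) l_n, while on {X_0 <= B} the weight costs only a
  factor exp (s0 B) = n^o(1), since l_n log n tends to infinity. Borel-Cantelli applies.
*)
theory Submission
  imports Defs
begin

text \<open>The kernel need not be symmetric, so no Gaussian process need stand behind X and
  everything is read off Laplace transforms. Two obstacles shape the proof. Taken alone, X_{1/n} is
  Gamma with scale l_n + 1 + f_n g_n, which does not tend to 0, so its tail beyond a multiple of l_n
  log n is not summable; the part of order 1 is a fluctuation shared by the coordinates, and the
  weight in X_0 removes it. In the other direction the coordinates are dependent, so the second
  Borel-Cantelli lemma does not apply; the product bound on the joint distribution function stands
  in for independence. That bound rests on nonnegative coefficients, which depend on a good basis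
  for the rank-two part. Summability of (1 - f_j) / l_j and (1 - g_j) / l_j supplies tails with sums
  at most 1/10, and this is room enough for all signs to come out right, however large the sum of 1
  / l_j becomes.\<close>

section \<open>Determinants of rank-two perturbations of diagonal matrices\<close>

text \<open>Sylvester's determinant identity. The block matrix \<open>?B\<close> has its lower left
  block cleared in two ways: by \<open>?R\<close> from the right, which leaves the large
  determinant, and by \<open>?L\<close> from the left, which leaves the small one.\<close>

lemma det_diag_plus_mult:
  fixes d :: "nat \<Rightarrow> real"
  assumes U: "U \<in> carrier_mat n k" and W: "W \<in> carrier_mat k n"
    and d: "\<And>i. i < n \<Longrightarrow> d i \<noteq> 0"
  shows "Determinant.det (mat_diag n d + U * W) =
    (\<Prod>i<n. d i) * Determinant.det (1\<^sub>m k + W * mat_diag n (\<lambda>i. 1 / d i) * U)"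
proof -
  let ?D = "mat_diag n d" and ?E = "mat_diag n (\<lambda>i. 1 / d i)"
  let ?B = "four_block_mat ?D (- U) W (1\<^sub>m k)"
  let ?R = "four_block_mat (1\<^sub>m n) (0\<^sub>m n k) (- W) (1\<^sub>m k)"
  let ?L = "four_block_mat (1\<^sub>m n) (0\<^sub>m n k) (- (W * ?E)) (1\<^sub>m k)"
  have B: "?B \<in> carrier_mat (n + k) (n + k)" and R: "?R \<in> carrier_mat (n + k) (n + k)"
    and L: "?L \<in> carrier_mat (n + k) (n + k)"
    using U W by auto
  have dets: "Determinant.det ?R = 1" "Determinant.det ?L = 1"
    using U W by (auto simp: det_four_block_mat_upper_right_zero[of _ n _ k])
  have UW: "U * W \<in> carrier_mat n n" using U W by auto
  have "?B * ?R = four_block_mat (?D + U * W) (- U) (0\<^sub>m k n) (1\<^sub>m k)"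
  proof (subst mult_four_block_mat)
    show "four_block_mat (?D * 1\<^sub>m n + - U * - W) (?D * 0\<^sub>m n k + - U * 1\<^sub>m k)
       (W * 1\<^sub>m n + 1\<^sub>m k * - W) (W * 0\<^sub>m n k + 1\<^sub>m k * 1\<^sub>m k) =
      four_block_mat (?D + U * W) (- U) (0\<^sub>m k n) (1\<^sub>m k)"
      using U W UW
      by (intro cong_four_block_mat)
        (auto simp: right_mult_one_mat[of _ n n] right_mult_zero_mat[of _ n n])
  qed (use U W in auto)
  hence det1: "Determinant.det ?B = Determinant.det (?D + U * W)"
    using det_mult[OF B R] dets U W UW
    by (simp add: det_four_block_mat_lower_left_zero[of _ n _ k])
  have "?L * ?B = four_block_mat ?D (- U) (0\<^sub>m k n) (1\<^sub>m k + W * ?E * U)"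
  proof (subst mult_four_block_mat)
    have 1: "W * ?E * ?D = W"
    proof -
      have "W * ?E * ?D = W * (?E * ?D)" using W by (intro assoc_mult_mat[of _ k n _ n _ n]) auto
      also have "?E * ?D = 1\<^sub>m n"
        using d unfolding mat_diag_diag by (auto simp: mat_diag_def intro!: eq_matI)
      finally show ?thesis using W by simp
    qed
    have "- (W * ?E) * ?D = - (W * ?E * ?D)"
      using W by (intro uminus_mult_left_mat) (simp add: mat_diag_def)
    hence 2: "- (W * ?E) * ?D + 1\<^sub>m k * W = 0\<^sub>m k n"
      using W 1 by auto
    have 3: "- (W * ?E) * - U + 1\<^sub>m k * 1\<^sub>m k = 1\<^sub>m k + W * ?E * U"
    proof -
      have WEU: "W * ?E * U \<in> carrier_mat k k" "W * ?E \<in> carrier_mat k n" using U W by auto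
      have "- (W * ?E) * - U = W * ?E * U"
      proof -
        have "dim_col (W * ?E) = dim_row U" "dim_col (W * ?E) = dim_row (- U)"
          using U by (simp_all add: mat_diag_def)
        thus ?thesis by (simp add: uminus_mult_left_mat uminus_mult_right_mat)
      qed
      thus ?thesis using WEU by (auto intro: comm_add_mat)
    qed
    show "four_block_mat (1\<^sub>m n * ?D + 0\<^sub>m n k * W) (1\<^sub>m n * - U + 0\<^sub>m n k * 1\<^sub>m k)
       (- (W * ?E) * ?D + 1\<^sub>m k * W) (- (W * ?E) * - U + 1\<^sub>m k * 1\<^sub>m k) =
      four_block_mat ?D (- U) (0\<^sub>m k n) (1\<^sub>m k + W * ?E * U)"
      unfolding 2 3 using U W
      by (intro cong_four_block_mat) (auto simp: left_mult_one_mat[of _ n n])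
  qed (use U W in auto)
  moreover have "Determinant.det (four_block_mat ?D (- U) (0\<^sub>m k n) (1\<^sub>m k + W * ?E * U)) =
      Determinant.det ?D * Determinant.det (1\<^sub>m k + W * ?E * U)"
    by (rule det_four_block_mat_lower_left_zero) (use U W in auto)
  ultimately have "Determinant.det ?B = Determinant.det ?D * Determinant.det (1\<^sub>m k + W * ?E * U)"
    using det_mult[OF L B] dets by simp
  moreover have "Determinant.det ?D = (\<Prod>i<n. d i)"
    by (subst det_upper_triangular[of _ n])
      (auto simp: mat_diag_def diag_mat_def prod.list_conv_set_nth atLeast0LessThan)
  ultimately show ?thesis using det1 by simp
qed

lemma det_carrier_mat_2:
  assumes "A \<in> carrier_mat 2 2"
  shows "Determinant.det A = A $$ (0,0) * A $$ (1,1) - A $$ (0,1) * (A $$ (1,0) :: real)"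
proof -
  let ?m = "\<lambda>i j. Matrix.mat 1 1 (\<lambda>_. A $$ (i,j))"
  have "A = four_block_mat (?m 0 0) (?m 0 1) (?m 1 0) (?m 1 1)"
    using assms by (intro eq_matI) (auto simp: numeral_2_eq_2 less_Suc_eq)
  moreover have "Determinant.det (four_block_mat (?m 0 0) (?m 0 1) (?m 1 0) (?m 1 1)) =
     Determinant.det (?m 0 0 * ?m 1 1 - ?m 0 1 * ?m 1 0)"
    by (rule det_four_block_mat) (auto simp: scalar_prod_def intro!: eq_matI)
  moreover have "Determinant.det (?m 0 0 * ?m 1 1 - ?m 0 1 * ?m 1 0) =
      A $$ (0,0) * A $$ (1,1) - A $$ (0,1) * A $$ (1,0)"
    by (subst det_single) (auto simp: scalar_prod_def)
  ultimately show ?thesis by simp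
qed

text \<open>The determinant of the identity plus the sum of w i times the column (1, g i) times the
  row (1, f i).\<close>

definition rank_two_det :: "nat \<Rightarrow> (nat \<Rightarrow> real) \<Rightarrow> (nat \<Rightarrow> real) \<Rightarrow> (nat \<Rightarrow> real) \<Rightarrow> real" where
  "rank_two_det n f g w =
    (1 + (\<Sum>i<n. w i)) * (1 + (\<Sum>i<n. w i * f i * g i)) - (\<Sum>i<n. w i * f i) * (\<Sum>i<n. w i * g i)"

text \<open>The entry 1 + f i * g j is the inner product of (1, f i) and (1, g j). Zero is allowed
  for \<open>l i\<close> so that the point 0 of T fits in, with l = 0 and f = g = 1.\<close>

lemma det_rank_two_kernel:
  assumes l: "\<And>i. i < n \<Longrightarrow> 0 \<le> l i" and s: "\<And>i. i < n \<Longrightarrow> 0 \<le> s i"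
    and K: "K \<in> carrier_mat n n"
      "\<And>i j. i < n \<Longrightarrow> j < n \<Longrightarrow> K $$ (i, j) = l i * (if i = j then 1 else 0) + 1 + f i * g j"
  shows "Determinant.det (1\<^sub>m n + K * mat_diag n s) =
    (\<Prod>i<n. 1 + l i * s i) * rank_two_det n f g (\<lambda>i. s i / (1 + l i * s i))"
proof -
  define d where "d i = 1 + l i * s i" for i
  have d: "d i \<noteq> 0" if "i < n" for i
    using l[OF that] s[OF that] by (simp add: d_def add_nonneg_eq_0_iff)
  define U where "U = Matrix.mat n 2 (\<lambda>(i, j). if j = 0 then 1 else f i)"
  define W where "W = Matrix.mat 2 n (\<lambda>(i, j). if i = 0 then s j else g j * s j)"
  have UW: "U \<in> carrier_mat n 2" "W \<in> carrier_mat 2 n" by (auto simp: U_def W_def)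
  have "K * mat_diag n s = Matrix.mat n n (\<lambda>(i, j). K $$ (i, j) * s j)"
    using K(1) by (rule mat_diag_mult_right)
  hence "1\<^sub>m n + K * mat_diag n s = mat_diag n d + U * W"
    by (intro eq_matI)
      (auto simp: mat_diag_def d_def U_def W_def scalar_prod_def numeral_2_eq_2 K(2) algebra_simps)
  moreover have "W * mat_diag n (\<lambda>i. 1 / d i) = Matrix.mat 2 n (\<lambda>(i, j). W $$ (i, j) * (1 / d j))"
    using UW(2) by (rule mat_diag_mult_right)
  hence "Determinant.det (1\<^sub>m 2 + W * mat_diag n (\<lambda>i. 1 / d i) * U) =
     rank_two_det n f g (\<lambda>i. s i / d i)"
    using UW
    by (subst det_carrier_mat_2)
      (auto simp: rank_two_det_def W_def U_def scalar_prod_def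
        atLeast0LessThan algebra_simps)
  ultimately show ?thesis
    using det_diag_plus_mult[OF UW, of d] d by (simp add: d_def)
qed

section \<open>Uniqueness of Laplace transforms\<close>

text \<open>The substitution y = exp (- x) maps the half-line into [0, 1] and turns Laplace
  transforms at natural numbers into moments; the Weierstrass theorem then passes from polynomials
  to continuous functions.\<close>

lemma integral_continuous_exp_eq:
  fixes \<mu> \<nu> :: "real measure" and \<phi> :: "real \<Rightarrow> real"
  assumes fin: "finite_measure \<mu>" "finite_measure \<nu>"
    and sets [measurable_cong]: "sets \<mu> = sets borel" "sets \<nu> = sets borel"
    and pos: "AE x in \<mu>. 0 \<le> x" "AE x in \<nu>. 0 \<le> x"
    and eq: "\<And>k::nat. (\<integral>\<^sup>+x. ennreal (exp (- (real k * x))) \<partial>\<mu>) = (\<integral>\<^sup>+x. ennreal (exp (- (real k * x))) \<partial>\<nu>)"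
    and \<phi>: "continuous_on {0..1} \<phi>" "\<phi> \<in> borel_measurable borel"
  shows "(\<integral>x. \<phi> (exp (- x)) \<partial>\<mu>) = (\<integral>x. \<phi> (exp (- x)) \<partial>\<nu>)"
proof -
  have int_exp: "integrable \<rho> (\<lambda>x. exp (- x) ^ k)"
    if "finite_measure \<rho>" "sets \<rho> = sets borel" "AE x in \<rho>. 0 \<le> x" for \<rho> :: "real measure" and k :: nat
  proof -
    interpret finite_measure \<rho> by fact
    note [measurable_cong] = that(2)
    show ?thesis
      using that(3) by (intro integrable_const_bound[where B=1]) (auto simp: power_le_one)
  qed
  have exp_pow: "exp (- x) ^ k = exp (- (real k * x))" for x :: real and k :: nat
    by (simp add: exp_of_nat_mult[symmetric])
  have mom: "(\<integral>x. exp (- x) ^ k \<partial>\<mu>) = (\<integral>x. exp (- x) ^ k \<partial>\<nu>)" for k :: nat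
    unfolding exp_pow using eq by (subst (1 2) integral_eq_nn_integral) auto
  obtain B where B: "\<And>y. y \<in> {0..1} \<Longrightarrow> \<bar>\<phi> y\<bar> \<le> B"
  proof -
    have "bounded (\<phi> ` {0..1})"
      using \<phi>(1) by (intro compact_imp_bounded compact_continuous_image) auto
    thus ?thesis using that by (force simp: bounded_iff)
  qed
  have int_\<phi>: "integrable \<rho> (\<lambda>x. \<phi> (exp (- x)))"
    if "finite_measure \<rho>" "sets \<rho> = sets borel" "AE x in \<rho>. 0 \<le> x" for \<rho> :: "real measure"
  proof -
    interpret finite_measure \<rho> by fact
    note [measurable_cong] = that(2) and [measurable] = \<phi>(2)
    show ?thesis
      using that(3) by (intro integrable_const_bound[where B=B]) (auto intro!: B)
  qed
  have close: "\<bar>(\<integral>x. \<phi> (exp (- x)) \<partial>\<rho>) - (\<integral>x. p (exp (- x)) \<partial>\<rho>)\<bar> \<le> e * measure \<rho> (space \<rho>)"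
    if \<rho>: "finite_measure \<rho>" "sets \<rho> = sets borel" "AE x in \<rho>. 0 \<le> x"
      and p: "integrable \<rho> (\<lambda>x. p (exp (- x)))" "\<And>y. y \<in> {0..1} \<Longrightarrow> \<bar>\<phi> y - p y\<bar> < e"
    for \<rho> :: "real measure" and p e
  proof -
    interpret finite_measure \<rho> by fact
    have "\<bar>(\<integral>x. \<phi> (exp (- x)) \<partial>\<rho>) - (\<integral>x. p (exp (- x)) \<partial>\<rho>)\<bar> = \<bar>\<integral>x. \<phi> (exp (- x)) - p (exp (- x)) \<partial>\<rho>\<bar>"
      using p(1) int_\<phi>[OF \<rho>] by simp
    also have "\<dots> \<le> (\<integral>x. \<bar>\<phi> (exp (- x)) - p (exp (- x))\<bar> \<partial>\<rho>)"
      using integral_norm_bound by simp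
    also have "\<dots> \<le> (\<integral>x. e \<partial>\<rho>)"
      using p \<rho>(3) int_\<phi>[OF \<rho>]
      by (intro integral_mono_AE) (auto intro!: less_imp_le)
    finally show ?thesis by (simp add: mult.commute)
  qed
  define m where "m = measure \<mu> (space \<mu>) + measure \<nu> (space \<nu>)"
  have "\<bar>(\<integral>x. \<phi> (exp (- x)) \<partial>\<mu>) - (\<integral>x. \<phi> (exp (- x)) \<partial>\<nu>)\<bar> \<le> 0 + e"
    if "e > 0" for e
  proof -
    define e' where "e' = e / (m + 1)"
    have m: "m \<ge> 0" by (simp add: m_def)
    hence e': "e' > 0" using that by (simp add: e'_def)
    obtain p where p: "real_polynomial_function p" "\<And>x. x \<in> {0..1} \<Longrightarrow> \<bar>\<phi> x - p x\<bar> < e'"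
      using Stone_Weierstrass_real_polynomial_function[OF _ \<phi>(1) e'] by auto
    then obtain a n where p_eq: "p = (\<lambda>x. \<Sum>i\<le>n. a i * x ^ i)"
      unfolding real_polynomial_function_iff_sum by auto
    have int_p: "integrable \<mu> (\<lambda>x. p (exp (- x)))" "integrable \<nu> (\<lambda>x. p (exp (- x)))"
      unfolding p_eq by (intro Bochner_Integration.integrable_sum integrable_mult_right int_exp fin sets pos)+
    have "(\<integral>x. p (exp (- x)) \<partial>\<mu>) = (\<integral>x. p (exp (- x)) \<partial>\<nu>)"
      unfolding p_eq
      using int_exp[OF fin(1) sets(1) pos(1)] int_exp[OF fin(2) sets(2) pos(2)] mom by simp
    hence "\<bar>(\<integral>x. \<phi> (exp (- x)) \<partial>\<mu>) - (\<integral>x. \<phi> (exp (- x)) \<partial>\<nu>)\<bar> \<le> e' * m"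
      using close[OF fin(1) sets(1) pos(1) int_p(1) p(2)] close[OF fin(2) sets(2) pos(2) int_p(2) p(2)]
      by (simp add: m_def distrib_left)
    also have "\<dots> \<le> e" using m that by (simp add: e'_def field_simps)
    finally show ?thesis by simp
  qed
  from field_le_epsilon[OF this] show ?thesis by simp
qed

text \<open>Finite measures instead of probability measures, because the laws compared later carry
  weights.\<close>

theorem laplace_transform_determines_cdf:
  fixes \<mu> \<nu> :: "real measure"
  assumes fin: "finite_measure \<mu>" "finite_measure \<nu>"
    and sets [measurable_cong]: "sets \<mu> = sets borel" "sets \<nu> = sets borel"
    and pos: "AE x in \<mu>. 0 \<le> x" "AE x in \<nu>. 0 \<le> x"
    and eq: "\<And>k::nat. (\<integral>\<^sup>+x. ennreal (exp (- (real k * x))) \<partial>\<mu>) = (\<integral>\<^sup>+x. ennreal (exp (- (real k * x))) \<partial>\<nu>)"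
  shows "emeasure \<mu> {..c} = emeasure \<nu> {..c}"
proof -
  \<comment> \<open>Ramps of slope \<open>j\<close> that equal 1 from exp (- c) on, so that the
    limit is the indicator of the closed half-line {..c}, with its endpoint.\<close>
  define \<phi> where "\<phi> j y = max 0 (min 1 (1 + real j * (y - exp (- c))))" for j y
  have lim: "(\<lambda>j. \<integral>x. \<phi> j (exp (- x)) \<partial>\<rho>) \<longlonglongrightarrow> measure \<rho> {..c}"
    if \<rho>: "finite_measure \<rho>" "sets \<rho> = sets borel" "AE x in \<rho>. 0 \<le> x" for \<rho> :: "real measure"
  proof -
    interpret finite_measure \<rho> by fact
    note [measurable_cong] = \<rho>(2)
    have "(\<lambda>j. \<integral>x. \<phi> j (exp (- x)) \<partial>\<rho>) \<longlonglongrightarrow> (\<integral>x. indicator {..c} x \<partial>\<rho>)"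
    proof (rule integral_dominated_convergence[where w="\<lambda>_. 1"])
      have "(\<lambda>j. \<phi> j (exp (- x))) \<longlonglongrightarrow> indicator {..c} x" for x
      proof (cases "x \<le> c")
        case True
        hence "\<phi> j (exp (- x)) = 1" for j by (simp add: \<phi>_def)
        thus ?thesis using True by simp
      next
        case False
        hence "filterlim (\<lambda>j. 1 + real j * (exp (- x) - exp (- c))) at_bot sequentially"
          by real_asymp
        hence "\<forall>\<^sub>F j in sequentially. 1 + real j * (exp (- x) - exp (- c)) \<le> 0"
          by (simp add: filterlim_at_bot)
        hence "\<forall>\<^sub>F j in sequentially. \<phi> j (exp (- x)) = 0"
          by eventually_elim (simp add: \<phi>_def)
        thus ?thesis using False by (simp add: tendsto_eventually)
      qed
      thus "AE x in \<rho>. (\<lambda>j. \<phi> j (exp (- x))) \<longlonglongrightarrow> indicator {..c} x"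
        by simp
    qed (auto simp: \<phi>_def)
    thus ?thesis using sets_eq_imp_space_eq[OF \<rho>(2)] by simp
  qed
  have "(\<lambda>j. \<integral>x. \<phi> j (exp (- x)) \<partial>\<mu>) = (\<lambda>j. \<integral>x. \<phi> j (exp (- x)) \<partial>\<nu>)"
    unfolding \<phi>_def by (intro ext integral_continuous_exp_eq assms continuous_intros) measurable
  hence "measure \<mu> {..c} = measure \<nu> {..c}"
    using lim[OF fin(1) sets(1) pos(1)] lim[OF fin(2) sets(2) pos(2)] LIMSEQ_unique by metis
  thus ?thesis
    using fin by (simp add: finite_measure.emeasure_eq_measure)
qed

section \<open>Gamma distributions\<close>

definition gamma_pdf :: "real \<Rightarrow> real \<Rightarrow> real \<Rightarrow> real" where
  "gamma_pdf b L y = (if 0 < y then y powr (b - 1) * exp (- y / L) / (Gamma b * L powr b) else 0)"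

definition gamma_measure :: "real \<Rightarrow> real \<Rightarrow> real measure" where
  "gamma_measure b L = density lborel (\<lambda>y. ennreal (gamma_pdf b L y))"

lemma gamma_pdf_measurable [measurable]: "gamma_pdf b L \<in> borel_measurable borel"
  unfolding gamma_pdf_def [abs_def] by measurable

lemma gamma_pdf_nonneg: "b > 0 \<Longrightarrow> 0 \<le> gamma_pdf b L y"
  by (simp add: gamma_pdf_def Gamma_real_pos less_imp_le)

lemma sets_gamma_measure [simp, measurable_cong]: "sets (gamma_measure b L) = sets borel"
  by (simp add: gamma_measure_def)

lemma space_gamma_measure [simp]: "space (gamma_measure b L) = UNIV"
  by (simp add: gamma_measure_def)

lemma gamma_pdf_laplace:
  assumes b: "b > 0" and L: "L > 0" and s: "1 + L * s > 0"
  shows "(\<integral>\<^sup>+y. ennreal (gamma_pdf b L y) * ennreal (exp (- (s * y))) \<partial>lborel) = ennreal ((1 + L * s) powr (- b))"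
proof -
  define c where "c = 1 / L + s"
  have c: "c > 0" and Lc: "L * c = 1 + L * s" using s L by (auto simp: c_def field_simps)
  define F where "F t = ennreal (t powr (b - 1) / exp t) * indicator {0..} t" for t :: real
  have [measurable]: "F \<in> borel_measurable borel" unfolding F_def by measurable
  have G: "Gamma b > 0" using b by (simp add: Gamma_real_pos)
  define K where "K = c powr (1 - b) / (Gamma b * L powr b)"
  have K: "K > 0" using c G L by (simp add: K_def)
  have "ennreal (Gamma b) = (\<integral>\<^sup>+t. F t \<partial>lborel)"
    unfolding F_def using Gamma_integral_real[OF b]
    by (intro nn_integral_has_integral_lebesgue'[symmetric]) auto
  also have "\<dots> = \<bar>c\<bar> * (\<integral>\<^sup>+t. F (0 + c * t) \<partial>lborel)"
    by (rule nn_integral_real_affine) (use c in auto)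
  finally have int: "ennreal c * (\<integral>\<^sup>+t. F (c * t) \<partial>lborel) = ennreal (Gamma b)"
    using c by simp
  have eq: "ennreal (gamma_pdf b L y) * ennreal (exp (- (s * y))) = ennreal K * F (c * y)" for y
  proof (cases "y > 0")
    case True
    have "gamma_pdf b L y * exp (- (s * y)) = K * ((c * y) powr (b - 1) / exp (c * y))"
    proof -
      have "exp (- y / L) * exp (- (s * y)) = 1 / exp (c * y)"
        by (simp add: exp_add[symmetric] exp_minus[symmetric] c_def algebra_simps divide_inverse)
      moreover have "K * (c * y) powr (b - 1) = y powr (b - 1) / (Gamma b * L powr b)"
      proof -
        have "c powr (1 - b) * c powr (b - 1) = 1" using c by (simp add: powr_add[symmetric])
        thus ?thesis using True c by (simp add: K_def powr_mult)
      qed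
      moreover have "gamma_pdf b L y * exp (- (s * y)) =
          y powr (b - 1) / (Gamma b * L powr b) * (exp (- y / L) * exp (- (s * y)))"
        using True by (simp add: gamma_pdf_def)
      ultimately show ?thesis by (metis mult.assoc mult.commute times_divide_eq_right mult.right_neutral)
    qed
    thus ?thesis using True c K b
      by (simp add: F_def ennreal_mult'[symmetric] gamma_pdf_nonneg)
  next
    case False
    hence "F (c * y) = 0"
      using c by (cases "y = 0") (auto simp: F_def indicator_def zero_le_mult_iff)
    thus ?thesis using False by (simp add: gamma_pdf_def)
  qed
  have "(\<integral>\<^sup>+y. ennreal (gamma_pdf b L y) * ennreal (exp (- (s * y))) \<partial>lborel) = ennreal K * (\<integral>\<^sup>+t. F (c * t) \<partial>lborel)"
    unfolding eq by (rule nn_integral_cmult) measurable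
  also have "\<dots> = ennreal (K / c) * (ennreal c * (\<integral>\<^sup>+t. F (c * t) \<partial>lborel))"
    using c K by (simp add: mult.assoc[symmetric] ennreal_mult'[symmetric])
  also have "\<dots> = ennreal (K / c * Gamma b)"
    unfolding int using c K G by (intro ennreal_mult'[symmetric]) auto
  also have "K / c * Gamma b = (L * c) powr (- b)"
    using c L G by (simp add: K_def powr_mult powr_diff powr_minus field_simps)
  finally show ?thesis unfolding Lc .
qed

lemma prob_space_gamma_measure:
  assumes "b > 0" "L > 0"
  shows "prob_space (gamma_measure b L)"
  using gamma_pdf_laplace[OF assms, of 0]
  by (intro prob_spaceI) (simp add: gamma_measure_def emeasure_density)

text \<open>Chernoff's bound with the exponential moment at t / L; \<open>t\<close> stays free so
  that it can be taken close to 1.\<close>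

lemma gamma_measure_tail_upper:
  assumes b: "b > 0" and L: "L > 0" and t: "0 \<le> t" "t < 1"
  shows "emeasure (gamma_measure b L) {c<..} \<le> ennreal ((1 - t) powr (- b) * exp (- (t * c / L)))"
proof -
  define s where "s = - (t / L)"
  have Ls: "1 + L * s = 1 - t" using L by (simp add: s_def)
  have "emeasure (gamma_measure b L) {c<..} = (\<integral>\<^sup>+y. ennreal (gamma_pdf b L y) * indicator {c<..} y \<partial>lborel)"
    by (simp add: gamma_measure_def emeasure_density)
  also have "\<dots> \<le> (\<integral>\<^sup>+y. ennreal (exp (s * c)) * (ennreal (gamma_pdf b L y) * ennreal (exp (- (s * y)))) \<partial>lborel)"
  proof (rule nn_integral_mono)
    fix y :: real
    have "1 \<le> exp (s * c) * exp (- (s * y))" if "y > c"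
    proof -
      have "0 \<le> t / L * (y - c)" using t L that by simp
      thus ?thesis by (simp add: exp_add[symmetric] s_def algebra_simps diff_divide_distrib)
    qed
    hence "gamma_pdf b L y \<le> exp (s * c) * (gamma_pdf b L y * exp (- (s * y)))" if "y > c"
      using that mult_left_mono[OF _ gamma_pdf_nonneg[OF b, of L y], of 1 "exp (s * c) * exp (- (s * y))"]
      by (simp add: mult_ac)
    thus "ennreal (gamma_pdf b L y) * indicator {c<..} y \<le> ennreal (exp (s * c)) * (ennreal (gamma_pdf b L y) * ennreal (exp (- (s * y))))"
      using b by (auto simp: indicator_def ennreal_mult'[symmetric] gamma_pdf_nonneg intro!: ennreal_leI)
  qed
  also have "\<dots> = ennreal (exp (s * c)) * ennreal ((1 - t) powr (- b))"
    using gamma_pdf_laplace[OF b L, of s] t Ls by (subst nn_integral_cmult) auto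
  also have "\<dots> = ennreal ((1 - t) powr (- b) * exp (- (t * c / L)))"
    by (simp add: ennreal_mult'[symmetric] s_def mult.commute)
  finally show ?thesis .
qed

text \<open>The density is bounded below on one interval of length \<open>L\<close>. There y / L is
  at least 1, so its power b - 1 is at least its inverse, whether or not \<open>b\<close> exceeds 1.
  The polynomial loss will be absorbed by \<epsilon>.\<close>

lemma gamma_measure_tail_lower:
  assumes b: "b > 0" and L: "L > 0" and x: "1 \<le> x"
  shows "ennreal (exp (- (x + 1)) / ((x + 1) * Gamma b)) \<le> emeasure (gamma_measure b L) {L * x<..}"
proof -
  have G: "Gamma b > 0" using b by (simp add: Gamma_real_pos)
  define m where "m = exp (- (x + 1)) / ((x + 1) * Gamma b)"
  have m: "m \<ge> 0" using x G by (simp add: m_def)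
  have "ennreal m = (\<integral>\<^sup>+y. ennreal (m / L) * indicator {L * x<..L * (x + 1)} y \<partial>lborel)"
    using L m by (subst nn_integral_cmult_indicator) (auto simp: ennreal_mult'[symmetric] algebra_simps)
  also have "\<dots> \<le> (\<integral>\<^sup>+y. ennreal (gamma_pdf b L y) * indicator {L * x<..} y \<partial>lborel)"
  proof (rule nn_integral_mono)
    fix y :: real
    have "m / L \<le> gamma_pdf b L y" if y: "L * x < y" "y \<le> L * (x + 1)"
    proof -
      define t where "t = y / L"
      have t: "1 \<le> t" "t \<le> x + 1" "y = L * t"
        using y L x by (auto simp: t_def field_simps intro: order_trans[of _ "L * x"])
      have y0: "y > 0" using t L by simp
      have "1 / (x + 1) \<le> 1 / t" using t by (intro divide_left_mono) auto
      also have "\<dots> = t powr (- 1)" using t by (simp add: powr_minus divide_inverse)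
      also have "\<dots> \<le> t powr (b - 1)" using t b by (intro powr_mono) auto
      finally have "exp (- (x + 1)) * (1 / (x + 1)) \<le> exp (- t) * t powr (b - 1)"
        using t by (intro mult_mono) auto
      hence "exp (- (x + 1)) * (1 / (x + 1)) / (Gamma b * L) \<le> exp (- t) * t powr (b - 1) / (Gamma b * L)"
        using G L by (intro divide_right_mono) auto
      also have "exp (- t) * t powr (b - 1) / (Gamma b * L) = gamma_pdf b L y"
        using y0 L t by (simp add: gamma_pdf_def powr_mult powr_diff t(3) field_simps)
      finally show ?thesis by (simp add: m_def field_simps)
    qed
    thus "ennreal (m / L) * indicator {L * x<..L * (x + 1)} y \<le> ennreal (gamma_pdf b L y) * indicator {L * x<..} y"
      by (auto simp: indicator_def intro!: ennreal_leI)
  qed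
  also have "\<dots> = emeasure (gamma_measure b L) {L * x<..}"
    by (simp add: gamma_measure_def emeasure_density)
  finally show ?thesis by (simp add: m_def)
qed

text \<open>The ratio of the two densities increases, so it crosses 1 at most once.\<close>

lemma gamma_measure_shape_mono:
  assumes b: "b > 0" and L: "L > 0"
  shows "emeasure (gamma_measure (b + real k) L) {..c} \<le> emeasure (gamma_measure b L) {..c}"
proof -
  define C where "C = Gamma b / (Gamma (b + real k) * L ^ k)"
  have C: "C > 0" using b L by (simp add: C_def Gamma_real_pos)
  have ratio: "gamma_pdf (b + real k) L y = gamma_pdf b L y * (C * y ^ k)" for y
  proof -
    have "Gamma b > 0" "Gamma (b + real k) > 0" using b by (auto intro!: Gamma_real_pos)
    thus ?thesis
      using L by (simp add: gamma_pdf_def C_def powr_add powr_diff powr_realpow field_simps)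
  qed
  have em: "emeasure (gamma_measure b' L) A = (\<integral>\<^sup>+y. ennreal (gamma_pdf b' L y) * indicator A y \<partial>lborel)"
    if "A \<in> sets borel" for b' A
    using that by (simp add: gamma_measure_def emeasure_density)
  show ?thesis
  \<comment> \<open>If the ratio \<open>C * y ^ k\<close> of the densities is at most 1 at
    \<open>c\<close>, it is so below \<open>c\<close>; otherwise it is at least 1 beyond
    \<open>c\<close>, and total mass 1 turns the comparison of the upper tails around.\<close>
  proof (cases "C * (max 0 c) ^ k \<le> 1")
    case True
    have "gamma_pdf (b + real k) L y \<le> gamma_pdf b L y" if "y \<le> c" for y
    proof (cases "y > 0")
      case y: True
      have "y ^ k \<le> max 0 c ^ k" using that y by (intro power_mono) auto
      hence "C * y ^ k \<le> C * max 0 c ^ k" using C by simp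
      hence "C * y ^ k \<le> 1" using True by linarith
      thus ?thesis unfolding ratio by (rule mult_left_le[OF _ gamma_pdf_nonneg[OF b]])
    qed (simp add: gamma_pdf_def)
    thus ?thesis
      unfolding em[OF atMost_borel]
      by (intro nn_integral_mono) (auto simp: indicator_def intro!: ennreal_leI)
  next
    case False
    have "gamma_pdf b L y \<le> gamma_pdf (b + real k) L y" if "y > c" for y
    proof (cases "y > 0")
      case y: True
      have "max 0 c ^ k \<le> y ^ k" using that y by (intro power_mono) auto
      hence "C * max 0 c ^ k \<le> C * y ^ k" using C by simp
      hence "1 \<le> C * y ^ k" using False by linarith
      thus ?thesis unfolding ratio using mult_left_mono[OF _ gamma_pdf_nonneg[OF b, of L y]] by force
    qed (simp add: gamma_pdf_def)
    hence *: "emeasure (gamma_measure b L) {c<..} \<le> emeasure (gamma_measure (b + real k) L) {c<..}"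
      unfolding em[OF greaterThan_borel]
      by (intro nn_integral_mono) (auto simp: indicator_def intro!: ennreal_leI)
    have compl: "emeasure (gamma_measure b' L) {..c} = 1 - emeasure (gamma_measure b' L) {c<..}"
      if "b' > 0" for b'
    proof -
      interpret prob_space "gamma_measure b' L" by (rule prob_space_gamma_measure[OF that L])
      have "{..c} = space (gamma_measure b' L) - {c<..}" by auto
      thus ?thesis using emeasure_compl[of "{c<..}" "gamma_measure b' L"] emeasure_space_1 by simp
    qed
    show ?thesis unfolding compl[OF b] using b * by (subst compl) (auto intro: ennreal_minus_mono)
  qed
qed

section \<open>Power series with nonnegative coefficients\<close>

text \<open>The monomials are listed by one index \<open>m\<close>, possibly with repetition, and
  the coefficients are extended reals: convergence and rearrangement then need no argument. The
  equation makes the sum finite on the cube, and \<open>0 \<le> F v\<close> is stated because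
  \<open>ennreal\<close> truncates negative values.\<close>

definition nonneg_power_series :: "nat \<Rightarrow> ((nat \<Rightarrow> real) \<Rightarrow> real) \<Rightarrow> bool" where
  "nonneg_power_series n F \<longleftrightarrow>
    (\<exists>(c :: nat \<Rightarrow> ennreal) (k :: nat \<Rightarrow> nat \<Rightarrow> nat). \<forall>v. (\<forall>i<n. v i \<in> {0..1}) \<longrightarrow>
      0 \<le> F v \<and> ennreal (F v) = (\<Sum>m. c m * ennreal (\<Prod>i<n. v i ^ k m i)))"

text \<open>Tonelli for the counting measure; it merges a series of series into a single list of
  monomials.\<close>

lemma suminf_ennreal_prod_decode:
  fixes h :: "nat \<Rightarrow> nat \<Rightarrow> ennreal"
  shows "(\<Sum>r m. h r m) = (\<Sum>j. h (fst (prod_decode j)) (snd (prod_decode j)))"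
proof -
  have "(\<Sum>r m. h r m) = (\<integral>\<^sup>+r. \<integral>\<^sup>+m. h r m \<partial>count_space UNIV \<partial>count_space UNIV)"
    by (simp add: nn_integral_count_space_nat)
  also have "\<dots> = (\<integral>\<^sup>+x. h (fst x) (snd x) \<partial>count_space UNIV)"
    by (subst nn_integral_fst_count_space[symmetric]) simp
  also have "\<dots> = (\<integral>\<^sup>+j. h (fst (prod_decode j)) (snd (prod_decode j)) \<partial>count_space UNIV)"
    by (rule nn_integral_bij_count_space[symmetric]) (rule bij_prod_decode)
  finally show ?thesis by (simp add: nn_integral_count_space_nat)
qed

lemma nonneg_power_series_nonneg:
  "nonneg_power_series n F \<Longrightarrow> (\<And>i. i < n \<Longrightarrow> v i \<in> {0..1}) \<Longrightarrow> 0 \<le> F v"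
  unfolding nonneg_power_series_def by blast

text \<open>Closure under infinite sums is what admits binomial series with a power series as
  argument.\<close>

lemma nonneg_power_series_sums:
  assumes F: "\<And>r. nonneg_power_series n (F r)"
    and G: "\<And>v. (\<And>i. i < n \<Longrightarrow> v i \<in> {0..1}) \<Longrightarrow> (\<lambda>r. F r v) sums G v"
  shows "nonneg_power_series n G"
proof -
  define P where "P r c k \<longleftrightarrow> (\<forall>v. (\<forall>i<n. v i \<in> {0..1}) \<longrightarrow>
      0 \<le> F r v \<and> ennreal (F r v) = (\<Sum>m. c m * ennreal (\<Prod>i<n. v i ^ k m i)))"
    for r and c :: "nat \<Rightarrow> ennreal" and k :: "nat \<Rightarrow> nat \<Rightarrow> nat"
  have "\<exists>c k. P r c k" for r
    using F[of r] unfolding nonneg_power_series_def P_def .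
  then obtain c k where "\<And>r. P r (c r) (k r)" by metis
  hence ck: "\<And>r v. (\<forall>i<n. v i \<in> {0..1}) \<Longrightarrow>
      0 \<le> F r v \<and> ennreal (F r v) = (\<Sum>m. c r m * ennreal (\<Prod>i<n. v i ^ k r m i))"
    unfolding P_def by blast
  show ?thesis
    unfolding nonneg_power_series_def
  proof (rule exI[of _ "\<lambda>j. c (fst (prod_decode j)) (snd (prod_decode j))"],
      rule exI[of _ "\<lambda>j. k (fst (prod_decode j)) (snd (prod_decode j))"], intro allI impI conjI)
    fix v :: "nat \<Rightarrow> real" assume v: "\<forall>i<n. v i \<in> {0..1}"
    note ck = ck[OF v]
    from G[of v] v have sums: "(\<lambda>r. F r v) sums G v" by blast
    show "0 \<le> G v" using sums_le[OF _ sums_zero sums] ck by blast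
    have "ennreal (G v) = (\<Sum>r. ennreal (F r v))"
      using sums ck by (intro suminf_ennreal_eq[symmetric]) auto
    also have "\<dots> = (\<Sum>r m. c r m * ennreal (\<Prod>i<n. v i ^ k r m i))" using ck by simp
    also have "\<dots> = (\<Sum>j. c (fst (prod_decode j)) (snd (prod_decode j)) *
        ennreal (\<Prod>i<n. v i ^ k (fst (prod_decode j)) (snd (prod_decode j)) i))"
      by (rule suminf_ennreal_prod_decode)
    finally show "ennreal (G v) = (\<Sum>j. c (fst (prod_decode j)) (snd (prod_decode j)) *
        ennreal (\<Prod>i<n. v i ^ k (fst (prod_decode j)) (snd (prod_decode j)) i))" .
  qed
qed

lemma nonneg_power_series_mult:
  assumes F: "nonneg_power_series n F" and G: "nonneg_power_series n G"
  shows "nonneg_power_series n (\<lambda>v. F v * G v)"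
proof -
  from F obtain c :: "nat \<Rightarrow> ennreal" and k :: "nat \<Rightarrow> nat \<Rightarrow> nat" where
    ck: "\<And>v. (\<forall>i<n. v i \<in> {0..1}) \<Longrightarrow>
      0 \<le> F v \<and> ennreal (F v) = (\<Sum>m. c m * ennreal (\<Prod>i<n. v i ^ k m i))"
    unfolding nonneg_power_series_def by blast
  from G obtain c' :: "nat \<Rightarrow> ennreal" and k' :: "nat \<Rightarrow> nat \<Rightarrow> nat" where
    ck': "\<And>v. (\<forall>i<n. v i \<in> {0..1}) \<Longrightarrow>
      0 \<le> G v \<and> ennreal (G v) = (\<Sum>m. c' m * ennreal (\<Prod>i<n. v i ^ k' m i))"
    unfolding nonneg_power_series_def by blast
  show ?thesis
    unfolding nonneg_power_series_def
  proof (rule exI[of _ "\<lambda>j. c (fst (prod_decode j)) * c' (snd (prod_decode j))"],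
      rule exI[of _ "\<lambda>j i. k (fst (prod_decode j)) i + k' (snd (prod_decode j)) i"], intro allI impI conjI)
    fix v :: "nat \<Rightarrow> real" assume v: "\<forall>i<n. v i \<in> {0..1}"
    note ck = ck[OF v] and ck' = ck'[OF v]
    show "0 \<le> F v * G v" using ck ck' by simp
    have nn: "0 \<le> (\<Prod>i<n. v i ^ e i)" for e :: "nat \<Rightarrow> nat"
      using v by (intro prod_nonneg) auto
    have "ennreal (F v * G v) = (\<Sum>m. c m * ennreal (\<Prod>i<n. v i ^ k m i)) * ennreal (G v)"
      using ck ck' by (simp add: ennreal_mult)
    also have "\<dots> = (\<Sum>r. c r * ennreal (\<Prod>i<n. v i ^ k r i) * ennreal (G v))"
      by (rule ennreal_suminf_multc[symmetric])
    also have "\<dots> = (\<Sum>r m. c r * ennreal (\<Prod>i<n. v i ^ k r i) * (c' m * ennreal (\<Prod>i<n. v i ^ k' m i)))"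
      using ck' by (simp only: ennreal_suminf_cmult)
    also have "\<dots> = (\<Sum>r m. c r * c' m * ennreal (\<Prod>i<n. v i ^ (k r i + k' m i)))"
      by (simp only: power_add prod.distrib ennreal_mult[OF nn nn] mult_ac)
    also have "\<dots> = (\<Sum>j. c (fst (prod_decode j)) * c' (snd (prod_decode j)) *
        ennreal (\<Prod>i<n. v i ^ (k (fst (prod_decode j)) i + k' (snd (prod_decode j)) i)))"
      by (rule suminf_ennreal_prod_decode)
    finally show "ennreal (F v * G v) = (\<Sum>j. c (fst (prod_decode j)) * c' (snd (prod_decode j)) *
        ennreal (\<Prod>i<n. v i ^ (k (fst (prod_decode j)) i + k' (snd (prod_decode j)) i)))" .
  qed
qed

lemma nonneg_power_series_const: "0 \<le> a \<Longrightarrow> nonneg_power_series n (\<lambda>v. a)"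
  unfolding nonneg_power_series_def
proof (rule exI[of _ "\<lambda>j. if j = 0 then ennreal a else 0"], rule exI[of _ "\<lambda>_ _. 0"], intro allI impI conjI)
  show "ennreal a = (\<Sum>m. (if m = (0::nat) then ennreal a else 0) * ennreal (\<Prod>i<n. v i ^ 0))" for v :: "nat \<Rightarrow> real"
    by (subst suminf_finite[of "{0}"]) auto
qed

lemma nonneg_power_series_var:
  assumes "i < n"
  shows "nonneg_power_series n (\<lambda>v. v i)"
  unfolding nonneg_power_series_def
proof (rule exI[of _ "\<lambda>j. if j = 0 then 1 else 0"], rule exI[of _ "\<lambda>_ j. if j = i then 1 else 0"], intro allI impI conjI)
  fix v :: "nat \<Rightarrow> real"
  have "(\<Prod>j<n. v j ^ (if j = i then 1 else 0)) = (\<Prod>j<n. if j = i then v i else 1)"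
    by (intro prod.cong) auto
  also have "\<dots> = v i" using assms by simp
  finally show "ennreal (v i) = (\<Sum>m. (if m = (0::nat) then 1 else 0) * ennreal (\<Prod>j<n. v j ^ (if j = i then 1 else 0)))"
    by (subst suminf_finite[of "{0}"]) auto
qed (use assms in auto)

lemma nonneg_power_series_power:
  "nonneg_power_series n F \<Longrightarrow> nonneg_power_series n (\<lambda>v. F v ^ k)"
  by (induction k) (auto intro: nonneg_power_series_const nonneg_power_series_mult)

lemma nonneg_power_series_sum:
  assumes "\<And>i. i < (N::nat) \<Longrightarrow> nonneg_power_series n (F i)"
  shows "nonneg_power_series n (\<lambda>v. \<Sum>i<N. F i v)"
proof (rule nonneg_power_series_sums[where F = "\<lambda>r. if r < N then F r else (\<lambda>v. 0)"])
  show "nonneg_power_series n (if r < N then F r else (\<lambda>v. 0))" for r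
    using assms by (auto intro: nonneg_power_series_const)
  show "(\<lambda>r. (if r < N then F r else (\<lambda>v. 0)) v) sums (\<Sum>i<N. F i v)" for v
  proof -
    have "(\<lambda>r. (if r < N then F r else (\<lambda>v. 0)) v) = (\<lambda>r. if r \<in> {..<N} then F r v else 0)"
      by auto
    thus ?thesis using sums_If_finite_set[of "{..<N}" "\<lambda>r. F r v"] by simp
  qed
qed

text \<open>Rising factorials display that all coefficients are nonnegative for positive
  \<open>b\<close>.\<close>

lemma neg_binomial_sums:
  fixes x b :: real
  assumes "\<bar>x\<bar> < 1"
  shows "(\<lambda>m. pochhammer b m / fact m * x ^ m) sums (1 - x) powr (- b)"
proof -
  have "(\<lambda>m. ((- b) gchoose m) * (- x) ^ m) sums (1 + - x) powr (- b)"
    using assms by (intro gen_binomial_real) simp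
  moreover have "((- b) gchoose m) * (- x) ^ m = pochhammer b m / fact m * x ^ m" for m
  proof -
    have "(- 1) ^ m * (- x) ^ m = x ^ m" by (subst power_mult_distrib[symmetric]) simp
    thus ?thesis by (simp add: gbinomial_pochhammer)
  qed
  ultimately show ?thesis by simp
qed

lemma nonneg_power_series_powr:
  assumes F: "nonneg_power_series n F" and b: "b > 0"
    and lt: "\<And>v. (\<And>i. i < n \<Longrightarrow> v i \<in> {0..1}) \<Longrightarrow> F v < 1"
  shows "nonneg_power_series n (\<lambda>v. (1 - F v) powr (- b))"
proof (rule nonneg_power_series_sums)
  show "nonneg_power_series n (\<lambda>v. pochhammer b m / fact m * F v ^ m)" for m
    using b by (intro nonneg_power_series_mult nonneg_power_series_const nonneg_power_series_power F)
      (simp add: pochhammer_nonneg)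
  show "(\<lambda>m. pochhammer b m / fact m * F v ^ m) sums (1 - F v) powr (- b)"
    if "\<And>i. i < n \<Longrightarrow> v i \<in> {0..1}" for v
    using lt[OF that] nonneg_power_series_nonneg[OF F that] by (intro neg_binomial_sums) simp
qed

text \<open>The cube coordinates \<open>v i = 1 / (1 + l i * s i)\<close> turn the determinant into
  \<open>rank_two_det\<close> at the weights \<open>(1 - v i) / l i\<close>. Factoring out its value at \<open>v = 0\<close> leaves
  \<open>det (I - P(v))\<close> for a \<open>2 \<times> 2\<close> matrix \<open>P\<close> linear in \<open>v\<close>; writing \<open>(1, g i)\<close> as a convex
  combination of \<open>(1, 1/2)\<close> and \<open>(1, 1)\<close> is the choice of basis that makes its entries
  nonnegative.\<close>

lemma rank_two_det_power_series:
  fixes l f g :: "nat \<Rightarrow> real"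
  assumes l: "\<And>i. i < n \<Longrightarrow> 0 < l i"
    and f: "\<And>i. i < n \<Longrightarrow> f i \<in> {0..1}" and g: "\<And>i. i < n \<Longrightarrow> g i \<in> {1/2..1}"
    and fsum: "(\<Sum>i<n. (1 - f i) / l i) \<le> 1 / 10" and gsum: "(\<Sum>i<n. (1 - g i) / l i) \<le> 1 / 10"
    and \<alpha>: "\<alpha> > 0"
  shows "nonneg_power_series n (\<lambda>v. rank_two_det n f g (\<lambda>i. (1 - v i) / l i) powr (- \<alpha>))"
    and "(\<And>i. i < n \<Longrightarrow> v i \<in> {0..1}) \<Longrightarrow> rank_two_det n f g (\<lambda>i. (1 - v i) / l i) > 0"
proof -
  define r where "r i = 1 / l i" for i
  have r: "0 < r i" if "i < n" for i using l[OF that] by (simp add: r_def)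
  define A0 F0 G0 D0 where defs0: "A0 = (\<Sum>i<n. r i)" "F0 = (\<Sum>i<n. f i * r i)"
    "G0 = (\<Sum>i<n. g i * r i)" "D0 = (\<Sum>i<n. f i * g i * r i)"
  define Q0 where "Q0 = (1 + A0) * (1 + D0) - F0 * G0"
  \<comment> \<open>\<open>A0\<close> has no bound independent of \<open>n\<close>, but
    \<open>F0\<close> and \<open>G0\<close> differ from it by \<open>p\<close> and \<open>q\<close>,
    at most 1/10 each. Everything is therefore expressed by \<open>A0\<close> and these
    deficits.\<close>
  define p where "p = (\<Sum>i<n. (1 - f i) * r i)"
  define q where "q = (\<Sum>i<n. (1 - g i) * r i)"
  define R where "R = (\<Sum>i<n. (1 - f i) * (1 - g i) * r i)"
  have pos: "0 \<le> p" "0 \<le> q" "0 \<le> R" "0 \<le> A0"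
    unfolding p_def q_def R_def defs0 using r f g by (auto intro!: sum_nonneg simp: less_imp_le)
  have p: "p \<le> 1/10" and q: "q \<le> 1/10" using fsum gsum by (simp_all add: p_def q_def r_def)
  have F0: "F0 = A0 - p" and G0: "G0 = A0 - q"
    by (simp_all add: defs0 p_def q_def sum_subtractf left_diff_distrib)
  have D0: "D0 = A0 - p - q + R"
    by (simp add: defs0 p_def q_def R_def sum_subtractf left_diff_distrib right_diff_distrib)
  \<comment> \<open>The squares of \<open>A0\<close> cancel, so \<open>Q0\<close> grows linearly;
    79/100 is 1 - 1/10 - 1/10 - 1/100.\<close>
  have "Q0 = 1 + 2 * A0 - p - q - p * q + R * (1 + A0)"
    unfolding Q0_def F0 G0 D0 by (simp add: algebra_simps)
  moreover have "p * q \<le> 1/10 * (1/10)" using p q pos by (intro mult_mono) auto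
  moreover have "0 \<le> R * (1 + A0)" using pos by simp
  ultimately have Q0: "2 * A0 + 79 / 100 \<le> Q0" using p q by linarith
  hence Q0_pos: "Q0 > 0" using pos by linarith

  \<comment> \<open>Let N0 be the matrix with rows (1 + A0, F0) and (G0, 1 + D0), so that
    \<open>Q0\<close> is its determinant. Then \<open>x i\<close> and \<open>y i\<close> are the row
    (1, f i) times the adjugate of N0 times the columns (1, 1/2) and (1, 1). The column (0, 1) would
    give f i plus the sum of (f i - f k) * r k, which can be negative.\<close>
  define x where "x i = (1 + D0 - F0 / 2) + f i * ((1 + A0) / 2 - G0)" for i
  define y where "y i = (1 + D0 - F0) + f i * ((1 + A0) - G0)" for i
  \<comment> \<open>In this form the large sums are gone. As f k - f i lies between - (1 - f k) and
    1, the summands are at least - (1 - f k) * r k here and - (1 - g k) * r k for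
    \<open>y i\<close>, so the sums are at least \<open>- p\<close> and \<open>- q\<close>.\<close>
  have x_eq: "x i = 1 + f i / 2 + (\<Sum>k<n. (f k - f i) * (g k - 1/2) * r k)" for i
    unfolding x_def defs0
    by (simp add: left_diff_distrib right_diff_distrib sum_subtractf sum_distrib_left[symmetric]
      sum_divide_distrib[symmetric] add_divide_distrib diff_divide_distrib distrib_left mult.assoc)
  have y_eq: "y i = 1 + f i + (\<Sum>k<n. (f k - f i) * (g k - 1) * r k)" for i
    unfolding y_def defs0
    by (simp add: left_diff_distrib right_diff_distrib sum_subtractf sum_distrib_left[symmetric]
      distrib_left mult.assoc)
  have x_nonneg: "0 \<le> x i" and x_le: "x i \<le> 3 / 2 + A0 / 2" and y_nonneg: "0 \<le> y i" if i: "i < n" for i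
  proof -
    have "- ((1 - f k) * r k) \<le> (f k - f i) * (g k - 1/2) * r k" if k: "k < n" for k
    proof -
      define h where "h = g k - 1/2"
      have "0 \<le> (1 - f i) * h + (1 - f k) * (1 - h)"
        using f[OF i] f[OF k] g[OF k] by (intro add_nonneg_nonneg mult_nonneg_nonneg) (auto simp: h_def)
      hence "- (1 - f k) \<le> (f k - f i) * (g k - 1/2)"
        unfolding h_def[symmetric] by (simp add: algebra_simps)
      from mult_right_mono[OF this, of "r k"] show ?thesis
        using r[OF k] by (simp only: mult_minus_left less_imp_le)
    qed
    hence "(\<Sum>k<n. - ((1 - f k) * r k)) \<le> (\<Sum>k<n. (f k - f i) * (g k - 1/2) * r k)"
      by (intro sum_mono) auto
    hence "- p \<le> (\<Sum>k<n. (f k - f i) * (g k - 1/2) * r k)" by (simp add: p_def sum_negf)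
    thus "0 \<le> x i" using f[OF i] p by (simp add: x_eq)
    \<comment> \<open>Growth like A0 / 2 is harmless: \<open>x i\<close> gets divided by
      \<open>Q0\<close>, which is at least 2 * A0 + 79/100.\<close>
    have "(f k - f i) * (g k - 1/2) * r k \<le> r k / 2" if k: "k < n" for k
    proof -
      have "(f k - f i) * (g k - 1/2) \<le> 1 * (1/2)"
        using f[OF i] f[OF k] g[OF k] by (intro mult_mono) auto
      from mult_right_mono[OF this, of "r k"] show ?thesis using r[OF k] by simp
    qed
    hence "(\<Sum>k<n. (f k - f i) * (g k - 1/2) * r k) \<le> (\<Sum>k<n. r k / 2)"
      by (intro sum_mono) auto
    thus "x i \<le> 3 / 2 + A0 / 2" using f[OF i] by (simp add: x_eq defs0 sum_divide_distrib)
    have "- ((1 - g k) * r k) \<le> (f k - f i) * (g k - 1) * r k" if k: "k < n" for k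
    proof -
      have "0 \<le> (1 - g k) * (1 - (f k - f i))"
        using f[OF i] f[OF k] g[OF k] by (intro mult_nonneg_nonneg) auto
      hence "- (1 - g k) \<le> (f k - f i) * (g k - 1)" by (simp add: algebra_simps)
      from mult_right_mono[OF this, of "r k"] show ?thesis
        using r[OF k] by (simp only: mult_minus_left less_imp_le)
    qed
    hence "(\<Sum>k<n. - ((1 - g k) * r k)) \<le> (\<Sum>k<n. (f k - f i) * (g k - 1) * r k)"
      by (intro sum_mono) auto
    hence "- q \<le> (\<Sum>k<n. (f k - f i) * (g k - 1) * r k)" by (simp add: q_def sum_negf)
    thus "0 \<le> y i" using f[OF i] q by (simp add: y_eq)
  qed

  \<comment> \<open>The entries of P(v). The factors 2 * (1 - g i) and 2 * g i - 1 are the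
    coordinates of (1, g i) in the basis (1, 1/2), (1, 1); both are nonnegative because g i is at
    least 1/2.\<close>
  define a b c d where ab: "a v = (\<Sum>i<n. x i * (2 * (1 - g i)) * r i / Q0 * v i)"
    "b v = (\<Sum>i<n. x i * (2 * g i - 1) * r i / Q0 * v i)"
    "c v = (\<Sum>i<n. y i * (2 * (1 - g i)) * r i / Q0 * v i)"
    "d v = (\<Sum>i<n. y i * (2 * g i - 1) * r i / Q0 * v i)" for v :: "nat \<Rightarrow> real"
  define Q where "Q v = rank_two_det n f g (\<lambda>i. (1 - v i) / l i)" for v
  have coef: "0 \<le> x i * (2 * (1 - g i)) * r i / Q0" "0 \<le> x i * (2 * g i - 1) * r i / Q0"
     "0 \<le> y i * (2 * (1 - g i)) * r i / Q0" "0 \<le> y i * (2 * g i - 1) * r i / Q0" if "i < n" for i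
    using g[OF that] r[OF that] x_nonneg[OF that] y_nonneg[OF that] Q0_pos by (auto simp: less_imp_le)
  have nps: "nonneg_power_series n a" "nonneg_power_series n b" "nonneg_power_series n c" "nonneg_power_series n d"
    unfolding ab using coef
    by (intro nonneg_power_series_sum nonneg_power_series_mult nonneg_power_series_const nonneg_power_series_var; blast)+
  have Q_eq: "Q v = Q0 * ((1 - a v) * (1 - d v) - b v * c v)" for v
  proof -
    define e where "e i = r i * v i" for i
    define A1 F1 G1 D1 where defs1: "A1 = (\<Sum>i<n. e i)" "F1 = (\<Sum>i<n. e i * f i)"
      "G1 = (\<Sum>i<n. e i * g i)" "D1 = (\<Sum>i<n. e i * f i * g i)"
    have lin: "(\<Sum>i<n. (P + f i * R) * (c0 + c1 * g i) * e i) =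
        P * (c0 * A1 + c1 * G1) + R * (c0 * F1 + c1 * D1)" for P R c0 c1
      by (simp add: defs1 sum.distrib sum_distrib_left algebra_simps)
    \<comment> \<open>These absorb the halves, so that the identity to be checked has integer
      coefficients.\<close>
    define h k where "h = F0 / 2" and "k = (1 + A0) / 2"
    have x_hk: "x i = (1 + D0 - h) + f i * (k - G0)" and y_hk: "y i = (1 + D0 - 2 * h) + f i * (2 * k - G0)" for i
      by (simp_all add: x_def y_def h_def k_def)
    have 1: "Q0 * a v = (1 + D0 - h) * (2 * A1 + (- 2) * G1) + (k - G0) * (2 * F1 + (- 2) * D1)"
    proof -
      have "Q0 * a v = (\<Sum>i<n. x i * (2 * (1 - g i)) * e i)"
        unfolding ab sum_distrib_left using Q0_pos by (intro sum.cong) (auto simp: e_def)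
      also have "\<dots> = (\<Sum>i<n. ((1 + D0 - h) + f i * (k - G0)) * (2 + (- 2) * g i) * e i)"
        unfolding x_hk by (intro sum.cong refl) (simp add: algebra_simps)
      finally show ?thesis by (simp only: lin)
    qed
    have 2: "Q0 * b v = (1 + D0 - h) * ((- 1) * A1 + 2 * G1) + (k - G0) * ((- 1) * F1 + 2 * D1)"
    proof -
      have "Q0 * b v = (\<Sum>i<n. x i * (2 * g i - 1) * e i)"
        unfolding ab sum_distrib_left using Q0_pos by (intro sum.cong) (auto simp: e_def)
      also have "\<dots> = (\<Sum>i<n. ((1 + D0 - h) + f i * (k - G0)) * ((- 1) + 2 * g i) * e i)"
        unfolding x_hk by (intro sum.cong refl) (simp add: algebra_simps)
      finally show ?thesis by (simp only: lin)
    qed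
    have 3: "Q0 * c v = (1 + D0 - 2 * h) * (2 * A1 + (- 2) * G1) + (2 * k - G0) * (2 * F1 + (- 2) * D1)"
    proof -
      have "Q0 * c v = (\<Sum>i<n. y i * (2 * (1 - g i)) * e i)"
        unfolding ab sum_distrib_left using Q0_pos by (intro sum.cong) (auto simp: e_def)
      also have "\<dots> = (\<Sum>i<n. ((1 + D0 - 2 * h) + f i * (2 * k - G0)) * (2 + (- 2) * g i) * e i)"
        unfolding y_hk by (intro sum.cong refl) (simp add: algebra_simps)
      finally show ?thesis by (simp only: lin)
    qed
    have 4: "Q0 * d v = (1 + D0 - 2 * h) * ((- 1) * A1 + 2 * G1) + (2 * k - G0) * ((- 1) * F1 + 2 * D1)"
    proof -
      have "Q0 * d v = (\<Sum>i<n. y i * (2 * g i - 1) * e i)"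
        unfolding ab sum_distrib_left using Q0_pos by (intro sum.cong) (auto simp: e_def)
      also have "\<dots> = (\<Sum>i<n. ((1 + D0 - 2 * h) + f i * (2 * k - G0)) * ((- 1) + 2 * g i) * e i)"
        unfolding y_hk by (intro sum.cong refl) (simp add: algebra_simps)
      finally show ?thesis by (simp only: lin)
    qed
    have "(\<Sum>i<n. (1 - v i) / l i) = A0 - A1" "(\<Sum>i<n. (1 - v i) / l i * f i) = F0 - F1"
      "(\<Sum>i<n. (1 - v i) / l i * g i) = G0 - G1" "(\<Sum>i<n. (1 - v i) / l i * f i * g i) = D0 - D1"
      unfolding defs0 defs1 e_def r_def sum_subtractf[symmetric]
      by (intro sum.cong; simp add: diff_divide_distrib left_diff_distrib)+
    hence "Q v = (2 * k - A1) * (1 + D0 - D1) - (2 * h - F1) * (G0 - G1)"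
      by (simp add: Q_def rank_two_det_def h_def k_def add_diff_eq)
    moreover have "Q0 = 2 * k * (1 + D0) - 2 * h * G0"
      by (simp add: Q0_def h_def k_def)
    \<comment> \<open>The product of the determinants at 0 and at \<open>v\<close>, with
      \<open>Q0\<close> kept as a factor so that no division occurs in the polynomial
      identity.\<close>
    ultimately have "Q0 * Q v = (Q0 - Q0 * a v) * (Q0 - Q0 * d v) - (Q0 * b v) * (Q0 * c v)"
      unfolding 1 2 3 4 by (simp only:) (simp add: algebra_simps)
    hence "Q0 * Q v = Q0 * (Q0 * ((1 - a v) * (1 - d v) - b v * c v))" by (simp add: algebra_simps)
    thus ?thesis using Q0_pos by simp
  qed

  \<comment> \<open>The top corner of the cube. The entries of P increase in \<open>v\<close>, so
    strict inequalities need checking only at \<open>u\<close>, where all weights vanish and the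
    determinant is 1.\<close>
  define u :: "nat \<Rightarrow> real" where "u = (\<lambda>_. 1)"
  have mono: "0 \<le> a v" "a v \<le> a u" "0 \<le> b v" "b v \<le> b u" "0 \<le> c v" "c v \<le> c u" "0 \<le> d v" "d v \<le> d u"
    if v: "\<And>i. i < n \<Longrightarrow> v i \<in> {0..1}" for v
  proof -
    have lin_mono: "0 \<le> (\<Sum>i<n. \<kappa> i * v i)" "(\<Sum>i<n. \<kappa> i * v i) \<le> (\<Sum>i<n. \<kappa> i * u i)"
      if "\<And>i. i < n \<Longrightarrow> 0 \<le> \<kappa> i" for \<kappa>
    proof -
      show "0 \<le> (\<Sum>i<n. \<kappa> i * v i)"
        using that v by (intro sum_nonneg mult_nonneg_nonneg) auto
      show "(\<Sum>i<n. \<kappa> i * v i) \<le> (\<Sum>i<n. \<kappa> i * u i)"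
        using that v by (intro sum_mono mult_left_mono) (auto simp: u_def)
    qed
    show "0 \<le> a v" "a v \<le> a u" "0 \<le> b v" "b v \<le> b u" "0 \<le> c v" "c v \<le> c u" "0 \<le> d v" "d v \<le> d u"
      unfolding ab by (rule lin_mono, erule coef)+
  qed
  \<comment> \<open>Only \<open>a\<close> has to be estimated: it carries the small factors 1 - g i.
    Once a u < 1, positivity of the determinant at \<open>u\<close> forces d u < 1.\<close>
  have "Q0 * a u = (\<Sum>i<n. (2 * x i) * ((1 - g i) * r i))"
    unfolding ab u_def sum_distrib_left using Q0_pos by (intro sum.cong refl) simp
  also have "\<dots> \<le> (\<Sum>i<n. (3 + A0) * ((1 - g i) * r i))"
  proof (intro sum_mono mult_right_mono)
    fix i assume "i \<in> {..<n}"
    hence i: "i < n" by simp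
    show "2 * x i \<le> 3 + A0" using x_le[OF i] by simp
    show "0 \<le> (1 - g i) * r i" using g[OF i] r[OF i] by simp
  qed
  also have "\<dots> = (3 + A0) * q" by (simp only: q_def sum_distrib_left)
  also have "\<dots> \<le> (3 + A0) * (1/10)" using q pos by (intro mult_left_mono) auto
  also have "\<dots> < Q0 * 1" using Q0 pos by simp
  finally have au: "a u < 1" using Q0_pos by simp
  have "Q u = 1" by (simp add: Q_def rank_two_det_def u_def)
  hence "0 < Q0 * ((1 - a u) * (1 - d u) - b u * c u)" using Q_eq[of u] by simp
  hence "0 < (1 - a u) * (1 - d u) - b u * c u" using Q0_pos by (rule zero_less_mult_pos)
  hence du': "b u * c u < (1 - a u) * (1 - d u)" by simp
  have "u i \<in> {0..1}" for i by (simp add: u_def)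
  hence "0 \<le> b u" "0 \<le> c u" using mono(3,5)[of u] by blast+
  hence "0 \<le> b u * c u" by simp
  hence "0 < (1 - a u) * (1 - d u)" using du' by (rule order_le_less_trans)
  moreover have "0 < 1 - a u" using au by simp
  ultimately have "0 < 1 - d u" by (rule zero_less_mult_pos)
  hence du: "d u < 1" by simp
  have a_lt: "a v < 1" and d_lt: "d v < 1" and bc_lt: "b v * c v < (1 - a v) * (1 - d v)"
    if v: "\<And>i. i < n \<Longrightarrow> v i \<in> {0..1}" for v
  proof -
    note m = mono[of v, OF v]
    show "a v < 1" "d v < 1" using m au du by auto
    have "b v * c v \<le> b u * c u" using m by (intro mult_mono) auto
    also have "\<dots> < (1 - a u) * (1 - d u)" by (rule du')
    also have "\<dots> \<le> (1 - a v) * (1 - d v)" using m au du by (intro mult_mono) auto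
    finally show "b v * c v < (1 - a v) * (1 - d v)" .
  qed
  show Q_pos: "rank_two_det n f g (\<lambda>i. (1 - v i) / l i) > 0"
    if "\<And>i. i < n \<Longrightarrow> v i \<in> {0..1}" for v
    using Q_eq[of v] bc_lt[of v, OF that] Q0_pos by (simp add: Q_def)

  \<comment> \<open>Writing det (I - P) as 1 - (a + d - a * d + b * c) would leave a negative
    coefficient at a * d. Instead (1 - a) * (1 - d) is factored out and the binomial series is taken
    in z = b * c / ((1 - a) * (1 - d)), which is below 1.\<close>
  have "nonneg_power_series n (\<lambda>v. Q v powr (- \<alpha>))"
  proof (rule nonneg_power_series_sums)
    show "nonneg_power_series n (\<lambda>v. Q0 powr (- \<alpha>) * (pochhammer \<alpha> k / fact k) * (b v * c v) ^ k *
       ((1 - a v) powr (- (\<alpha> + real k)) * (1 - d v) powr (- (\<alpha> + real k))))" for k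
      using \<alpha> a_lt d_lt
      by (intro nonneg_power_series_mult nonneg_power_series_const nonneg_power_series_power
         nonneg_power_series_powr nps) (auto simp: pochhammer_nonneg)
    show "(\<lambda>k. Q0 powr (- \<alpha>) * (pochhammer \<alpha> k / fact k) * (b v * c v) ^ k *
       ((1 - a v) powr (- (\<alpha> + real k)) * (1 - d v) powr (- (\<alpha> + real k)))) sums (Q v powr (- \<alpha>))"
      if v: "\<And>i. i < n \<Longrightarrow> v i \<in> {0..1}" for v
    proof -
      define h where "h = (1 - a v) * (1 - d v)"
      have h: "h > 0" using a_lt[of v, OF v] d_lt[of v, OF v] by (simp add: h_def)
      define z where "z = b v * c v / h"
      have z: "0 \<le> z" "z < 1"
        using bc_lt[of v, OF v] mono[of v, OF v] h by (auto simp: z_def h_def[symmetric])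
      have "(\<lambda>k. (Q0 * h) powr (- \<alpha>) * (pochhammer \<alpha> k / fact k * z ^ k)) sums ((Q0 * h) powr (- \<alpha>) * (1 - z) powr (- \<alpha>))"
        using z by (intro sums_mult neg_binomial_sums) auto
      moreover have "(Q0 * h) powr (- \<alpha>) * (1 - z) powr (- \<alpha>) = Q v powr (- \<alpha>)"
      proof -
        have "Q v = Q0 * h * (1 - z)" using h by (simp add: Q_eq h_def[symmetric] z_def field_simps)
        thus ?thesis using h Q0_pos z by (simp add: powr_mult)
      qed
      moreover have "(Q0 * h) powr (- \<alpha>) * (pochhammer \<alpha> k / fact k * z ^ k) =
        Q0 powr (- \<alpha>) * (pochhammer \<alpha> k / fact k) * (b v * c v) ^ k *
       ((1 - a v) powr (- (\<alpha> + real k)) * (1 - d v) powr (- (\<alpha> + real k)))" for k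
      proof -
        have "(1 - a v) powr (- (\<alpha> + real k)) * (1 - d v) powr (- (\<alpha> + real k)) = h powr (- (\<alpha> + real k))"
          using a_lt[of v, OF v] d_lt[of v, OF v] by (simp add: h_def powr_mult)
        also have "\<dots> = h powr (- \<alpha>) / h ^ k"
          using h by (simp add: powr_diff powr_realpow)
        finally show ?thesis using h Q0_pos by (simp add: z_def powr_mult power_divide field_simps)
      qed
      ultimately show ?thesis by (simp only:)
    qed
  qed
  thus "nonneg_power_series n (\<lambda>v. rank_two_det n f g (\<lambda>i. (1 - v i) / l i) powr (- \<alpha>))"
    by (simp add: Q_def)
qed

section \<open>From Laplace transforms to distribution functions, one coordinate at a time\<close>

text \<open>\<open>W\<close> stands for whatever depends on the remaining coordinates, so
  one-dimensional uniqueness suffices. The case k = 0 equates the total masses, which gives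
  finiteness on the right and the statement about upper tails.\<close>

lemma laplace_weighted_cdf:
  fixes X :: "'a \<Rightarrow> real" and \<delta> :: "real \<Rightarrow> ennreal"
  assumes [measurable]: "X \<in> borel_measurable M" "W \<in> borel_measurable M" "\<delta> \<in> borel_measurable borel"
    and W: "(\<integral>\<^sup>+\<omega>. W \<omega> \<partial>M) < \<infinity>"
    and X: "\<And>\<omega>. \<omega> \<in> space M \<Longrightarrow> 0 \<le> X \<omega>" and \<delta>: "\<And>y. y < 0 \<Longrightarrow> \<delta> y = 0"
    and eq: "\<And>k::nat. (\<integral>\<^sup>+\<omega>. W \<omega> * ennreal (exp (- (real k * X \<omega>))) \<partial>M) =
       (\<integral>\<^sup>+y. \<delta> y * ennreal (exp (- (real k * y))) \<partial>lborel)"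
  shows "(\<integral>\<^sup>+\<omega>. W \<omega> * indicator {..c} (X \<omega>) \<partial>M) = (\<integral>\<^sup>+y. \<delta> y * indicator {..c} y \<partial>lborel)" (is ?le)
    and "(\<integral>\<^sup>+\<omega>. W \<omega> * indicator {c<..} (X \<omega>) \<partial>M) = (\<integral>\<^sup>+y. \<delta> y * indicator {c<..} y \<partial>lborel)" (is ?gt)
proof -
  define \<mu> where "\<mu> = distr (density M W) borel X"
  define \<nu> where "\<nu> = density lborel \<delta>"
  have sets [measurable_cong, simp]: "sets \<mu> = sets borel" "sets \<nu> = sets borel"
    by (simp_all add: \<mu>_def \<nu>_def)
  have space [simp]: "space \<mu> = UNIV" "space \<nu> = UNIV"
    by (simp_all add: \<mu>_def \<nu>_def)
  have int_\<mu>: "(\<integral>\<^sup>+x. h x \<partial>\<mu>) = (\<integral>\<^sup>+\<omega>. W \<omega> * h (X \<omega>) \<partial>M)" if [measurable]: "h \<in> borel_measurable borel" for h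
    unfolding \<mu>_def by (simp add: nn_integral_distr nn_integral_density)
  have int_\<nu>: "(\<integral>\<^sup>+x. h x \<partial>\<nu>) = (\<integral>\<^sup>+y. \<delta> y * h y \<partial>lborel)" if [measurable]: "h \<in> borel_measurable borel" for h
    unfolding \<nu>_def by (simp add: nn_integral_density)
  have em_\<mu>: "emeasure \<mu> A = (\<integral>\<^sup>+\<omega>. W \<omega> * indicator A (X \<omega>) \<partial>M)"
    if "A \<in> sets borel" for A
    using int_\<mu>[of "indicator A"] that by simp
  have em_\<nu>: "emeasure \<nu> A = (\<integral>\<^sup>+y. \<delta> y * indicator A y \<partial>lborel)"
    if "A \<in> sets borel" for A
    using int_\<nu>[of "indicator A"] that by simp
  have total: "emeasure \<mu> UNIV = emeasure \<nu> UNIV"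
    using eq[of 0] by (simp add: em_\<mu> em_\<nu>)
  have fin: "finite_measure \<mu>" "finite_measure \<nu>"
    using W total by (auto intro!: finite_measureI simp: em_\<mu>)
  have "AE x in \<mu>. 0 \<le> x"
    unfolding \<mu>_def using X by (subst AE_distr_iff) (auto simp: AE_density)
  moreover have "AE x in \<nu>. 0 \<le> x"
    unfolding \<nu>_def using \<delta> by (auto simp: AE_density not_le[symmetric] intro!: AE_I2)
  ultimately have "emeasure \<mu> {..c} = emeasure \<nu> {..c}"
    using eq by (intro laplace_transform_determines_cdf fin sets) (simp_all add: int_\<mu> int_\<nu>)
  moreover have "emeasure \<rho> {c<..} = emeasure \<rho> UNIV - emeasure \<rho> {..c}"
    if "finite_measure \<rho>" "sets \<rho> = sets borel" for \<rho> :: "real measure"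
  proof -
    interpret finite_measure \<rho> by fact
    have "{c<..} = UNIV - {..c}" by auto
    thus ?thesis using that sets_eq_imp_space_eq[OF that(2)] emeasure_compl[of "{..c}" \<rho>] by simp
  qed
  ultimately show ?le ?gt
    using fin total by (simp_all add: em_\<mu>[symmetric] em_\<nu>[symmetric])
qed

text \<open>Replaces a multivariate uniqueness theorem. By induction, the exponentials of the first
  \<open>r\<close> coordinates are exchanged for indicators while the other coordinates keep
  theirs.\<close>

lemma product_mixture_cdf:
  fixes X :: "nat \<Rightarrow> 'a \<Rightarrow> real" and \<delta> :: "nat \<Rightarrow> nat \<Rightarrow> real \<Rightarrow> ennreal" and c :: "nat \<Rightarrow> ennreal"
  assumes M: "prob_space M"
    and X [measurable]: "\<And>i. i < n \<Longrightarrow> X i \<in> borel_measurable M"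
    and X_nonneg: "\<And>i \<omega>. i < n \<Longrightarrow> \<omega> \<in> space M \<Longrightarrow> 0 \<le> X i \<omega>"
    and \<delta> [measurable]: "\<And>m i. \<delta> m i \<in> borel_measurable borel"
    and \<delta>_neg: "\<And>m i y. y < 0 \<Longrightarrow> \<delta> m i y = 0"
    and laplace: "\<And>s. (\<And>i. i < n \<Longrightarrow> 0 \<le> s i) \<Longrightarrow>
      (\<integral>\<^sup>+\<omega>. (\<Prod>i<n. ennreal (exp (- (s i * X i \<omega>)))) \<partial>M) =
      (\<Sum>m. c m * (\<Prod>i<n. \<integral>\<^sup>+y. \<delta> m i y * ennreal (exp (- (s i * y))) \<partial>lborel))"
  shows "(\<integral>\<^sup>+\<omega>. (\<Prod>i<n. indicator {..x i} (X i \<omega>)) \<partial>M) =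
    (\<Sum>m. c m * (\<Prod>i<n. \<integral>\<^sup>+y. \<delta> m i y * indicator {..x i} y \<partial>lborel))"
proof -
  interpret prob_space M by fact
  define \<phi> :: "nat \<Rightarrow> (nat \<Rightarrow> real) \<Rightarrow> nat \<Rightarrow> real \<Rightarrow> ennreal" where
    "\<phi> r s i y = (if i < r then indicator {..x i} y else ennreal (exp (- (s i * y))))" for r s i y
  have [measurable]: "\<phi> r s i \<in> borel_measurable borel" for r s i
    unfolding \<phi>_def [abs_def] by (cases "i < r") auto
  have \<phi>_le: "\<phi> r s i y \<le> 1" if "0 \<le> s i" "0 \<le> y" for r s i y
    using that by (auto simp: \<phi>_def indicator_def)
  have "(\<integral>\<^sup>+\<omega>. (\<Prod>i<n. \<phi> r s i (X i \<omega>)) \<partial>M) =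
    (\<Sum>m. c m * (\<Prod>i<n. \<integral>\<^sup>+y. \<delta> m i y * \<phi> r s i y \<partial>lborel))"
    if "r \<le> n" "\<And>i. i < n \<Longrightarrow> 0 \<le> s i" for r s
    using that
  proof (induction r arbitrary: s)
    case 0
    thus ?case using laplace[of s] by (simp add: \<phi>_def)
  next
    case (Suc r)
    have r: "r < n" and s: "\<And>i. i < n \<Longrightarrow> 0 \<le> s i" using Suc.prems by auto
    define J where "J = {..<n} - {r}"
    have J: "finite J" "r \<notin> J" "{..<n} = insert r J" "\<And>i. i \<in> J \<Longrightarrow> i < n"
      using r by (auto simp: J_def)
    define W where "W \<omega> = (\<Prod>i\<in>J. \<phi> r s i (X i \<omega>))" for \<omega>
    define C where "C m = c m * (\<Prod>i\<in>J. \<integral>\<^sup>+y. \<delta> m i y * \<phi> r s i y \<partial>lborel)" for m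
    have [measurable]: "W \<in> borel_measurable M"
      unfolding W_def [abs_def]
      by (intro borel_measurable_prod_ennreal measurable_compose[OF X]) (use J in auto)
    have [measurable]: "X r \<in> borel_measurable M" by (rule X[OF r])
    have W_le: "W \<omega> \<le> 1" if "\<omega> \<in> space M" for \<omega>
      unfolding W_def using X_nonneg s J that by (intro prod_le_1) (auto intro!: \<phi>_le)
    have "(\<integral>\<^sup>+\<omega>. W \<omega> \<partial>M) \<le> (\<integral>\<^sup>+\<omega>. 1 \<partial>M)"
      by (intro nn_integral_mono W_le)
    hence W_fin: "(\<integral>\<^sup>+\<omega>. W \<omega> \<partial>M) < \<infinity>"
      using emeasure_space_1 by (simp add: order_le_less_trans[of _ 1])
    have swap: "(\<Sum>m. C m * (\<integral>\<^sup>+y. \<delta> m r y * h y \<partial>lborel)) = (\<integral>\<^sup>+y. (\<Sum>m. C m * \<delta> m r y) * h y \<partial>lborel)"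
      if [measurable]: "h \<in> borel_measurable borel" for h
      by (simp add: nn_integral_cmult[symmetric] nn_integral_suminf[symmetric] ennreal_suminf_multc[symmetric] mult.assoc)
    have "(\<integral>\<^sup>+\<omega>. W \<omega> * indicator {..x r} (X r \<omega>) \<partial>M) =
        (\<integral>\<^sup>+y. (\<Sum>m. C m * \<delta> m r y) * indicator {..x r} y \<partial>lborel)"
    proof (rule laplace_weighted_cdf)
      fix k :: nat
      \<comment> \<open>Only parameter \<open>r\<close> moves. The induction hypothesis is applied
        to \<open>s'\<close> for every \<open>k\<close>, hence the generalization over
        \<open>s\<close>.\<close>
      define s' where "s' = s(r := real k)"
      have same: "\<phi> r s' i = \<phi> r s i" if "i \<in> J" for i
        using that J by (auto simp: \<phi>_def s'_def fun_eq_iff)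
      have at_r: "\<phi> r s' r y = ennreal (exp (- (real k * y)))" for y by (simp add: \<phi>_def s'_def)
      have "(\<integral>\<^sup>+\<omega>. (\<Prod>i<n. \<phi> r s' i (X i \<omega>)) \<partial>M) =
          (\<Sum>m. c m * (\<Prod>i<n. \<integral>\<^sup>+y. \<delta> m i y * \<phi> r s' i y \<partial>lborel))"
        using r s by (intro Suc.IH) (auto simp: s'_def)
      hence "(\<integral>\<^sup>+\<omega>. W \<omega> * ennreal (exp (- (real k * X r \<omega>))) \<partial>M) =
         (\<Sum>m. C m * (\<integral>\<^sup>+y. \<delta> m r y * ennreal (exp (- (real k * y))) \<partial>lborel))"
        using J by (simp add: same at_r W_def C_def mult_ac)
      thus "(\<integral>\<^sup>+\<omega>. W \<omega> * ennreal (exp (- (real k * X r \<omega>))) \<partial>M) =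
         (\<integral>\<^sup>+y. (\<Sum>m. C m * \<delta> m r y) * ennreal (exp (- (real k * y))) \<partial>lborel)"
        by (simp add: swap)
    qed (use X_nonneg r \<delta>_neg W_fin in auto)
    also have "\<dots> = (\<Sum>m. C m * (\<integral>\<^sup>+y. \<delta> m r y * indicator {..x r} y \<partial>lborel))"
      by (simp add: swap)
    finally have eq: "(\<integral>\<^sup>+\<omega>. W \<omega> * indicator {..x r} (X r \<omega>) \<partial>M) =
       (\<Sum>m. C m * (\<integral>\<^sup>+y. \<delta> m r y * indicator {..x r} y \<partial>lborel))" .
    have same: "\<phi> (Suc r) s i = \<phi> r s i" if "i \<in> J" for i
      using that J by (auto simp: \<phi>_def fun_eq_iff less_Suc_eq)
    have at_r: "\<phi> (Suc r) s r = indicator {..x r}" by (simp add: \<phi>_def fun_eq_iff)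
    show ?case using eq J by (simp add: same at_r W_def C_def mult_ac)
  qed
  from this[of n "\<lambda>_. 0"] show ?thesis by (simp add: \<phi>_def)
qed

section \<open>Permanental vectors\<close>

context prob_space
begin

lemma permanental_vector_nn_laplace:
  assumes X: "permanental_vector \<alpha> n K X" and s: "\<And>i. i < n \<Longrightarrow> 0 \<le> s i"
  shows "(\<integral>\<^sup>+\<omega>. (\<Prod>i<n. ennreal (exp (- (s i * X i \<omega>)))) \<partial>M) =
    ennreal (1 / Determinant.det (1\<^sub>m n + K * mat_diag n s) powr \<alpha>)"
proof -
  have X_meas [measurable]: "X i \<in> borel_measurable M" if "i < n" for i
    using X that by (auto simp: permanental_vector_def)
  have X_nonneg: "0 \<le> X i \<omega>" if "i < n" "\<omega> \<in> space M" for i \<omega>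
    using X that by (auto simp: permanental_vector_def)
  have [measurable]: "(\<lambda>\<omega>. exp (- (\<Sum>i<n. s i * X i \<omega>))) \<in> borel_measurable M"
  proof -
    have [measurable]: "(\<lambda>\<omega>. \<Sum>i<n. s i * X i \<omega>) \<in> borel_measurable M"
      by (intro borel_measurable_sum borel_measurable_times borel_measurable_const X_meas) auto
    show ?thesis by measurable
  qed
  have "0 \<le> (\<Sum>i<n. s i * X i \<omega>)" if "\<omega> \<in> space M" for \<omega>
    using s X_nonneg that by (auto intro!: sum_nonneg)
  hence int: "integrable M (\<lambda>\<omega>. exp (- (\<Sum>i<n. s i * X i \<omega>)))"
    by (intro integrable_const_bound[where B = 1]) auto
  have "(\<integral>\<^sup>+\<omega>. (\<Prod>i<n. ennreal (exp (- (s i * X i \<omega>)))) \<partial>M) =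
      (\<integral>\<^sup>+\<omega>. ennreal (exp (- (\<Sum>i<n. s i * X i \<omega>))) \<partial>M)"
    by (simp add: prod_ennreal exp_sum sum_negf[symmetric])
  also have "\<dots> = ennreal (expectation (\<lambda>\<omega>. exp (- (\<Sum>i<n. s i * X i \<omega>))))"
    by (intro nn_integral_eq_integral int) simp
  also have "expectation (\<lambda>\<omega>. exp (- (\<Sum>i<n. s i * X i \<omega>))) =
      1 / Determinant.det (1\<^sub>m n + K * mat_diag n s) powr \<alpha>"
    using X s by (simp add: permanental_vector_def)
  finally show ?thesis .
qed

lemma permanental_joint_cdf_le:
  assumes X: "permanental_vector \<alpha> n K X"
    and K: "\<And>i j. i < n \<Longrightarrow> j < n \<Longrightarrow> K $$ (i, j) = l i * (if i = j then 1 else 0) + 1 + f i * g j"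
    and l: "\<And>i. i < n \<Longrightarrow> 0 < l i"
    and f: "\<And>i. i < n \<Longrightarrow> f i \<in> {0..1}" and g: "\<And>i. i < n \<Longrightarrow> g i \<in> {1/2..1}"
    and fsum: "(\<Sum>i<n. (1 - f i) / l i) \<le> 1 / 10" and gsum: "(\<Sum>i<n. (1 - g i) / l i) \<le> 1 / 10"
  shows "emeasure M {\<omega> \<in> space M. \<forall>i<n. X i \<omega> \<le> x i} \<le> (\<Prod>i<n. emeasure (gamma_measure \<alpha> (l i)) {..x i})"
proof -
  have \<alpha>: "\<alpha> > 0" and K_carrier: "K \<in> carrier_mat n n"
    using X by (auto simp: permanental_vector_def)
  have X_meas [measurable]: "X i \<in> borel_measurable M" if "i < n" for i
    using X that by (auto simp: permanental_vector_def)
  have X_nonneg: "0 \<le> X i \<omega>" if "i < n" "\<omega> \<in> space M" for i \<omega>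
    using X that by (auto simp: permanental_vector_def)
  define Q where "Q v = rank_two_det n f g (\<lambda>i. (1 - v i) / l i)" for v
  have "nonneg_power_series n (\<lambda>v. Q v powr (- \<alpha>))"
    unfolding Q_def by (rule rank_two_det_power_series(1)[OF l f g fsum gsum \<alpha>])
  then obtain c :: "nat \<Rightarrow> ennreal" and k :: "nat \<Rightarrow> nat \<Rightarrow> nat" where
    ck: "\<And>v. (\<forall>i<n. v i \<in> {0..1}) \<Longrightarrow>
      ennreal (Q v powr (- \<alpha>)) = (\<Sum>m. c m * ennreal (\<Prod>i<n. v i ^ k m i))"
    unfolding nonneg_power_series_def by blast
  define \<delta> where "\<delta> m i y = ennreal (gamma_pdf (\<alpha> + real (k m i)) (l i) y)" for m i y
  have "(\<integral>\<^sup>+\<omega>. (\<Prod>i<n. indicator {..x i} (X i \<omega>)) \<partial>M) =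
    (\<Sum>m. c m * (\<Prod>i<n. \<integral>\<^sup>+y. \<delta> m i y * indicator {..x i} y \<partial>lborel))"
  proof (rule product_mixture_cdf[OF prob_space_axioms X_meas X_nonneg])
    show "\<delta> m i \<in> borel_measurable borel" for m i unfolding \<delta>_def [abs_def] by measurable
    show "\<delta> m i y = 0"
      if "y < 0" for m i y using that by (simp add: \<delta>_def gamma_pdf_def)
    fix s :: "nat \<Rightarrow> real" assume s: "\<And>i. i < n \<Longrightarrow> 0 \<le> s i"
    \<comment> \<open>These coordinates map parameters in [0, \<infinity>) into the cube on which
      the series converges.\<close>
    define v where "v i = 1 / (1 + l i * s i)" for i
    have ls: "0 < 1 + l i * s i" if "i < n" for i
      using l[OF that] s[OF that] by (simp add: add_pos_nonneg)
    have v: "v i \<in> {0..1}" if "i < n" for i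
      using ls[OF that] l[OF that] s[OF that] by (auto simp: v_def divide_le_eq)
    have Qpos: "Q v > 0"
      unfolding Q_def by (rule rank_two_det_power_series(2)[OF l f g fsum gsum \<alpha> v])
    have "rank_two_det n f g (\<lambda>i. s i / (1 + l i * s i)) = Q v"
    proof -
      have "s i / (1 + l i * s i) = (1 - v i) / l i" if "i < n" for i
      proof -
        have "1 - v i = l i * (s i / (1 + l i * s i))"
          using ls[OF that] by (simp add: v_def diff_divide_eq_iff)
        thus ?thesis using l[OF that] by simp
      qed
      thus ?thesis by (simp add: Q_def rank_two_det_def)
    qed
    hence "Determinant.det (1\<^sub>m n + K * mat_diag n s) = (\<Prod>i<n. 1 + l i * s i) * Q v"
      using l s det_rank_two_kernel[OF _ s K_carrier K] by (simp add: less_imp_le)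
    moreover have prod_pos: "0 < (\<Prod>i<n. 1 + l i * s i)" using ls by (intro prod_pos) auto
    ultimately have det: "1 / Determinant.det (1\<^sub>m n + K * mat_diag n s) powr \<alpha> =
        (\<Prod>i<n. 1 + l i * s i) powr (- \<alpha>) * Q v powr (- \<alpha>)"
      using Qpos by (simp add: powr_mult powr_minus field_simps)
    have nn: "0 \<le> (\<Prod>i<n. v i ^ k m i)" for m using v by (intro prod_nonneg) auto
    \<comment> \<open>Each factor \<open>v i\<close> raises the shape of coordinate \<open>i\<close>
      by 1 and leaves its scale alone.\<close>
    have step: "(\<Prod>i<n. 1 + l i * s i) powr (- \<alpha>) * (\<Prod>i<n. v i ^ k m i) =
        (\<Prod>i<n. (1 + l i * s i) powr (- (\<alpha> + real (k m i))))" for m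
    proof -
      have "(\<Prod>i<n. 1 + l i * s i) powr (- \<alpha>) = (\<Prod>i<n. (1 + l i * s i) powr (- \<alpha>))"
        using ls by (simp add: prod_powr_distrib less_imp_le)
      moreover have "(1 + l i * s i) powr (- \<alpha>) * v i ^ k m i = (1 + l i * s i) powr (- (\<alpha> + real (k m i)))"
        if "i < n" for i
        using ls[OF that] by (simp add: v_def powr_diff powr_realpow power_divide)
      ultimately show ?thesis by (simp add: prod.distrib[symmetric])
    qed
    have "(\<integral>\<^sup>+\<omega>. (\<Prod>i<n. ennreal (exp (- (s i * X i \<omega>)))) \<partial>M) =
        ennreal ((\<Prod>i<n. 1 + l i * s i) powr (- \<alpha>)) * ennreal (Q v powr (- \<alpha>))"
      by (simp add: permanental_vector_nn_laplace[OF X s] det ennreal_mult)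
    also have "\<dots> = (\<Sum>m. ennreal ((\<Prod>i<n. 1 + l i * s i) powr (- \<alpha>)) * (c m * ennreal (\<Prod>i<n. v i ^ k m i)))"
    proof -
      have "ennreal (Q v powr (- \<alpha>)) = (\<Sum>m. c m * ennreal (\<Prod>i<n. v i ^ k m i))"
        using ck[of v] v by blast
      thus ?thesis by (simp only: ennreal_suminf_cmult)
    qed
    also have "\<dots> = (\<Sum>m. c m * ennreal ((\<Prod>i<n. 1 + l i * s i) powr (- \<alpha>) * (\<Prod>i<n. v i ^ k m i)))"
      by (intro suminf_cong) (simp only: ennreal_mult[OF powr_ge_zero nn] mult.left_commute)
    also have "\<dots> = (\<Sum>m. c m * (\<Prod>i<n. ennreal ((1 + l i * s i) powr (- (\<alpha> + real (k m i))))))"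
      unfolding step by (simp add: prod_ennreal)
    also have "\<dots> = (\<Sum>m. c m * (\<Prod>i<n. \<integral>\<^sup>+y. \<delta> m i y * ennreal (exp (- (s i * y))) \<partial>lborel))"
      unfolding \<delta>_def using \<alpha> l ls by (intro suminf_cong arg_cong2[of _ _ _ _ times] prod.cong refl gamma_pdf_laplace[symmetric]) auto
    finally show "(\<integral>\<^sup>+\<omega>. (\<Prod>i<n. ennreal (exp (- (s i * X i \<omega>)))) \<partial>M) =
        (\<Sum>m. c m * (\<Prod>i<n. \<integral>\<^sup>+y. \<delta> m i y * ennreal (exp (- (s i * y))) \<partial>lborel))" .
  qed
  also have "\<dots> \<le> (\<Sum>m. c m * (\<Prod>i<n. emeasure (gamma_measure \<alpha> (l i)) {..x i}))"
  proof (intro suminf_le mult_left_mono prod_mono_ennreal)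
    fix m i assume "i \<in> {..<n}"
    hence "(\<integral>\<^sup>+y. \<delta> m i y * indicator {..x i} y \<partial>lborel) = emeasure (gamma_measure (\<alpha> + real (k m i)) (l i)) {..x i}"
      by (simp add: \<delta>_def gamma_measure_def emeasure_density)
    thus "(\<integral>\<^sup>+y. \<delta> m i y * indicator {..x i} y \<partial>lborel) \<le> emeasure (gamma_measure \<alpha> (l i)) {..x i}"
      using gamma_measure_shape_mono[OF \<alpha> l] \<open>i \<in> {..<n}\<close> by simp
  qed auto
  also have "\<dots> = (\<Sum>m. c m) * (\<Prod>i<n. emeasure (gamma_measure \<alpha> (l i)) {..x i})"
    by simp
  \<comment> \<open>At v = 1, that is s = 0, all monomials are 1 and so is the determinant: the
    mixing weights form a probability distribution.\<close>
  also have "(\<Sum>m. c m) = 1"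
  proof -
    have "Q (\<lambda>_. 1) = 1" by (simp add: Q_def rank_two_det_def)
    thus ?thesis using ck[of "\<lambda>_. 1"] by simp
  qed
  also have "(\<integral>\<^sup>+\<omega>. (\<Prod>i<n. indicator {..x i} (X i \<omega>)) \<partial>M) = emeasure M {\<omega> \<in> space M. \<forall>i<n. X i \<omega> \<le> x i}"
  proof -
    have "(\<Prod>i<n. indicator {..x i} (X i \<omega>)) = (indicator {\<omega> \<in> space M. \<forall>i<n. X i \<omega> \<le> x i} \<omega> :: ennreal)"
      if "\<omega> \<in> space M" for \<omega>
      using that by (auto simp: indicator_def prod_zero_iff)
    hence "(\<integral>\<^sup>+\<omega>. (\<Prod>i<n. indicator {..x i} (X i \<omega>)) \<partial>M) =
        (\<integral>\<^sup>+\<omega>. indicator {\<omega> \<in> space M. \<forall>i<n. X i \<omega> \<le> x i} \<omega> \<partial>M)"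
      by (intro nn_integral_cong)
    thus ?thesis by simp
  qed
  finally show ?thesis by simp
qed

text \<open>For fixed \<open>s0\<close> the determinant is affine in the other parameter, so the
  weighted law is exactly a multiple of one Gamma law. The multiple is (1 + 2 * s0) powr (-
  \<alpha>), which is bounded by 1.\<close>

lemma permanental_pair_tail_le:
  assumes X: "permanental_vector \<alpha> 2 K X"
    and K: "K $$ (0, 0) = 2" "K $$ (0, 1) = 1 + g" "K $$ (1, 0) = 1 + f" "K $$ (1, 1) = l + 1 + f * g"
    and l: "0 < l" and f: "0 \<le> f" "f \<le> 1" and g: "0 \<le> g" "g \<le> 1" and s0: "0 \<le> s0"
  shows "emeasure M {\<omega> \<in> space M. c < X 1 \<omega> \<and> X 0 \<omega> \<le> B} \<le> ennreal (exp (s0 * B)) *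
    emeasure (gamma_measure \<alpha> (l + (1 + f * g + s0 * ((1 - f) * (1 - g))) / (1 + 2 * s0))) {c<..}"
proof -
  have \<alpha>: "\<alpha> > 0" and K_carrier: "K \<in> carrier_mat 2 2"
    using X by (auto simp: permanental_vector_def)
  have X_meas [measurable]: "X 0 \<in> borel_measurable M" "X 1 \<in> borel_measurable M"
    using X by (auto simp: permanental_vector_def)
  have X_nonneg: "0 \<le> X 0 \<omega>" "0 \<le> X 1 \<omega>"
    if "\<omega> \<in> space M" for \<omega>
    using X that by (auto simp: permanental_vector_def)
  define a where "a = 1 + 2 * s0"
  define b where "b = 1 + f * g + s0 * ((1 - f) * (1 - g))"
  define L where "L = l + b / a"
  have a: "1 \<le> a" using s0 by (simp add: a_def)
  have b: "0 \<le> b" using f g s0 by (simp add: b_def)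
  have L: "0 < L" using a b l by (simp add: L_def add_pos_nonneg)
  define W where "W \<omega> = ennreal (exp (- (s0 * X 0 \<omega>)))" for \<omega>
  have [measurable]: "W \<in> borel_measurable M" unfolding W_def [abs_def] by measurable
  have W_le: "W \<omega> \<le> 1" if "\<omega> \<in> space M" for \<omega>
    using X_nonneg[OF that] s0 by (simp add: W_def)
  have "(\<integral>\<^sup>+\<omega>. W \<omega> \<partial>M) \<le> (\<integral>\<^sup>+\<omega>. 1 \<partial>M)"
    by (intro nn_integral_mono W_le)
  hence W_fin: "(\<integral>\<^sup>+\<omega>. W \<omega> \<partial>M) < \<infinity>"
    using emeasure_space_1 by (simp add: order_le_less_trans[of _ 1])
  define \<delta> where "\<delta> y = ennreal (a powr (- \<alpha>)) * ennreal (gamma_pdf \<alpha> L y)" for y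
  have [measurable]: "\<delta> \<in> borel_measurable borel"
    unfolding \<delta>_def [abs_def] by measurable
  have "(\<integral>\<^sup>+\<omega>. W \<omega> * indicator {c<..} (X 1 \<omega>) \<partial>M) = (\<integral>\<^sup>+y. \<delta> y * indicator {c<..} y \<partial>lborel)"
  proof (rule laplace_weighted_cdf(2)[OF X_meas(2) _ _ W_fin X_nonneg(2)])
    show "\<delta> y = 0" if "y < 0" for y using that by (simp add: \<delta>_def gamma_pdf_def)
    fix k :: nat
    define s where "s i = (if i = 0 then s0 else real k)" for i :: nat
    \<comment> \<open>Index 0 is the point 0 of T: l = 0 and f = g = 1 reproduce the entries 2, 1 +
      g and 1 + f.\<close>
    define l' f' g' where defs': "l' i = (if i = 0 then 0 else l)" "f' i = (if i = 0 then 1 else f)"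
      "g' i = (if i = 0 then 1 else g)" for i :: nat
    have lk: "1 + l * real k > 0" using l by (simp add: add_pos_nonneg)
    have "Determinant.det (1\<^sub>m 2 + K * mat_diag 2 s) =
        (\<Prod>i<2. 1 + l' i * s i) * rank_two_det 2 f' g' (\<lambda>i. s i / (1 + l' i * s i))"
      using K_carrier K s0 l by (intro det_rank_two_kernel) (auto simp: s_def defs' less_2_cases_iff)
    also have "\<dots> = a * (1 + L * real k)"
    proof -
      define w where "w = real k / (1 + l * real k)"
      have lw: "(1 + l * real k) * w = real k" using lk by (simp add: w_def)
      have "(\<Prod>i<2. 1 + l' i * s i) * rank_two_det 2 f' g' (\<lambda>i. s i / (1 + l' i * s i)) =
          (1 + l * real k) * ((1 + (s0 + w)) * (1 + (s0 + w * f * g)) - (s0 + w * f) * (s0 + w * g))"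
        by (simp add: numeral_2_eq_2 rank_two_det_def s_def defs' w_def)
      \<comment> \<open>The squares of \<open>w\<close> and of \<open>s0\<close> cancel, which
        leaves an expression of degree 1 in \<open>w\<close>.\<close>
      also have "\<dots> = (1 + l * real k) * a + ((1 + l * real k) * w) * b"
        by (simp add: a_def b_def algebra_simps)
      also have "\<dots> = a * (1 + L * real k)"
        using a unfolding lw L_def by (simp add: field_simps)
      finally show ?thesis .
    qed
    finally have det: "Determinant.det (1\<^sub>m 2 + K * mat_diag 2 s) = a * (1 + L * real k)" .
    have Lk: "0 < 1 + L * real k" using L by (simp add: add_pos_nonneg)
    have "(\<integral>\<^sup>+\<omega>. W \<omega> * ennreal (exp (- (real k * X 1 \<omega>))) \<partial>M) =
        (\<integral>\<^sup>+\<omega>. (\<Prod>i<2. ennreal (exp (- (s i * X i \<omega>)))) \<partial>M)"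
      by (simp add: numeral_2_eq_2 W_def s_def)
    also have "\<dots> = ennreal (1 / Determinant.det (1\<^sub>m 2 + K * mat_diag 2 s) powr \<alpha>)"
      using s0 by (intro permanental_vector_nn_laplace[OF X]) (auto simp: s_def)
    also have "1 / Determinant.det (1\<^sub>m 2 + K * mat_diag 2 s) powr \<alpha> = a powr (- \<alpha>) * (1 + L * real k) powr (- \<alpha>)"
      unfolding det using a Lk powr_mult[of a "1 + L * real k" \<alpha>] by (simp only: powr_minus) (simp add: divide_inverse)
    also have "ennreal \<dots> = ennreal (a powr (- \<alpha>)) * (\<integral>\<^sup>+y. ennreal (gamma_pdf \<alpha> L y) * ennreal (exp (- (real k * y))) \<partial>lborel)"
      using gamma_pdf_laplace[OF \<alpha> L Lk] by (simp add: ennreal_mult)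
    also have "\<dots> = (\<integral>\<^sup>+y. \<delta> y * ennreal (exp (- (real k * y))) \<partial>lborel)"
      by (simp add: \<delta>_def nn_integral_cmult[symmetric] mult.assoc)
    finally show "(\<integral>\<^sup>+\<omega>. W \<omega> * ennreal (exp (- (real k * X 1 \<omega>))) \<partial>M) =
        (\<integral>\<^sup>+y. \<delta> y * ennreal (exp (- (real k * y))) \<partial>lborel)" .
  qed measurable
  also have "\<dots> \<le> emeasure (gamma_measure \<alpha> L) {c<..}"
  proof -
    have "a powr (- \<alpha>) \<le> 1"
      using a \<alpha> by (simp add: powr_minus ge_one_powr_ge_zero inverse_le_1_iff)
    hence "\<delta> y \<le> ennreal (gamma_pdf \<alpha> L y)" for y
      using mult_right_mono[of "ennreal (a powr (- \<alpha>))" 1 "ennreal (gamma_pdf \<alpha> L y)"] by (simp add: \<delta>_def)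
    thus ?thesis
      unfolding gamma_measure_def by (subst emeasure_density) (auto intro!: nn_integral_mono mult_right_mono)
  qed
  finally have *: "(\<integral>\<^sup>+\<omega>. W \<omega> * indicator {c<..} (X 1 \<omega>) \<partial>M) \<le> emeasure (gamma_measure \<alpha> L) {c<..}" .
  have "emeasure M {\<omega> \<in> space M. c < X 1 \<omega> \<and> X 0 \<omega> \<le> B} =
      (\<integral>\<^sup>+\<omega>. indicator {\<omega> \<in> space M. c < X 1 \<omega> \<and> X 0 \<omega> \<le> B} \<omega> \<partial>M)"
    by (rule nn_integral_indicator[symmetric]) measurable
  also have "\<dots> \<le> (\<integral>\<^sup>+\<omega>. ennreal (exp (s0 * B)) * (W \<omega> * indicator {c<..} (X 1 \<omega>)) \<partial>M)"
  proof (rule nn_integral_mono)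
    fix \<omega> assume "\<omega> \<in> space M"
    have "1 \<le> ennreal (exp (s0 * B)) * W \<omega>" if "X 0 \<omega> \<le> B"
    proof -
      have "1 \<le> exp (s0 * B) * exp (- (s0 * X 0 \<omega>))"
        using mult_left_mono[OF that s0] by (simp add: exp_add[symmetric])
      thus ?thesis by (simp add: W_def ennreal_mult'[symmetric])
    qed
    thus "indicator {\<omega> \<in> space M. c < X 1 \<omega> \<and> X 0 \<omega> \<le> B} \<omega> \<le>
        ennreal (exp (s0 * B)) * (W \<omega> * indicator {c<..} (X 1 \<omega>))"
      by (auto simp: indicator_def)
  qed
  also have "\<dots> = ennreal (exp (s0 * B)) * (\<integral>\<^sup>+\<omega>. W \<omega> * indicator {c<..} (X 1 \<omega>) \<partial>M)"
    by (rule nn_integral_cmult) measurable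
  also have "\<dots> \<le> ennreal (exp (s0 * B)) * emeasure (gamma_measure \<alpha> L) {c<..}"
    by (intro mult_left_mono *) simp
  finally show ?thesis by (simp add: L_def a_def b_def)
qed

end

section \<open>Almost sure growth\<close>

text \<open>Uniform in the scale because the threshold is proportional to it. The tail is of order
  n^(-(1 - \<epsilon>)) up to logarithms and so eventually exceeds 1 / n, the value for which the
  product over \<open>n\<close> telescopes.\<close>

lemma eventually_gamma_measure_atMost_le:
  assumes \<alpha>: "\<alpha> > 0" and \<epsilon>: "0 < \<epsilon>" "\<epsilon> < 1"
  shows "\<forall>\<^sub>F n in sequentially. \<forall>L>0.
    emeasure (gamma_measure \<alpha> L) {..L * ((1 - \<epsilon>) * ln (real n))} \<le> ennreal (1 - 1 / real n)"
proof -
  have G: "Gamma \<alpha> > 0" using \<alpha> by (simp add: Gamma_real_pos)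
  have "\<forall>\<^sub>F n in sequentially. 1 \<le> (1 - \<epsilon>) * ln (real n)"
    using \<epsilon> by real_asymp
  moreover have "\<forall>\<^sub>F n in sequentially.
      1 / real n \<le> exp (- ((1 - \<epsilon>) * ln (real n) + 1)) / (((1 - \<epsilon>) * ln (real n) + 1) * Gamma \<alpha>)"
    using \<epsilon> G by real_asymp
  ultimately show ?thesis
  proof eventually_elim
    case (elim n)
    show ?case
    proof (intro allI impI)
      fix L :: real assume L: "L > 0"
      interpret gamma: prob_space "gamma_measure \<alpha> L" by (rule prob_space_gamma_measure[OF \<alpha> L])
      define y where "y = (1 - \<epsilon>) * ln (real n)"
      have "{..L * y} = space (gamma_measure \<alpha> L) - {L * y<..}" by auto
      hence "emeasure (gamma_measure \<alpha> L) {..L * y} = 1 - emeasure (gamma_measure \<alpha> L) {L * y<..}"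
        using emeasure_compl[of "{L * y<..}" "gamma_measure \<alpha> L"] gamma.emeasure_space_1 by simp
      also have "\<dots> \<le> 1 - ennreal (1 / real n)"
      proof (rule ennreal_minus_mono)
        have "ennreal (1 / real n) \<le> ennreal (exp (- (y + 1)) / ((y + 1) * Gamma \<alpha>))"
          using elim(2) by (intro ennreal_leI) (simp add: y_def)
        also have "\<dots> \<le> emeasure (gamma_measure \<alpha> L) {L * y<..}"
          using elim(1) by (intro gamma_measure_tail_lower[OF \<alpha> L]) (simp add: y_def)
        finally show "ennreal (1 / real n) \<le> emeasure (gamma_measure \<alpha> L) {L * y<..}" .
      qed simp
      also have "\<dots> = ennreal (1 - 1 / real n)" by (simp add: ennreal_minus[symmetric])
      finally show "emeasure (gamma_measure \<alpha> L) {..L * ((1 - \<epsilon>) * ln (real n))} \<le> ennreal (1 - 1 / real n)"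
        by (simp add: y_def)
    qed
  qed
qed

text \<open>Telescoping; the right-hand side tends to 0 as \<open>m\<close> grows, which plays the
  part of the divergence of the harmonic series.\<close>

lemma prod_one_minus_inverse:
  assumes "2 \<le> N"
  shows "(\<Prod>i<m. 1 - 1 / real (N + i)) = (real N - 1) / (real N + real m - 1)"
proof (induction m)
  case (Suc m)
  thus ?case using assms by (simp add: field_simps)
qed (use assms in simp)

text \<open>\<open>K\<close> is there because the sequences of the theorem have known signs only
  from index 2 on.\<close>

lemma summable_tail_sum_le:
  fixes h :: "nat \<Rightarrow> real"
  assumes "summable h" "\<And>j. K \<le> j \<Longrightarrow> 0 \<le> h j" "0 < r"
  shows "\<forall>\<^sub>F N in sequentially. \<forall>m. (\<Sum>i<m. h (N + i)) \<le> r"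
proof -
  obtain N0 where N0: "\<And>N. N \<ge> N0 \<Longrightarrow> norm (\<Sum>i. h (i + N)) < r"
    using suminf_exist_split[OF assms(3,1)] by blast
  have "(\<Sum>i<m. h (N + i)) \<le> r" if "N \<ge> max N0 K" for N m
  proof -
    have "(\<Sum>i<m. h (i + N)) \<le> (\<Sum>i. h (i + N))"
      using that assms by (intro sum_le_suminf) (auto simp: summable_iff_shift)
    thus ?thesis using N0[of N] that by (simp add: add.commute)
  qed
  thus ?thesis unfolding eventually_sequentially by blast
qed

theorem theorem1p2:
  fixes M :: "'a measure"
    and T :: "real set"
    and l f g :: "nat \<Rightarrow> real"
    and U :: "real \<Rightarrow> real \<Rightarrow> real"
    and \<alpha> :: real
    and X :: "real \<Rightarrow> 'a \<Rightarrow> real"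
  assumes T: "T = insert 0 {1 / real j | j. j \<ge> 2}"
    and l_pos: "\<And>j. j \<ge> 2 \<Longrightarrow> 0 < l j"
    and f: "\<And>j. j \<ge> 2 \<Longrightarrow> 0 < f j \<and> f j < 1"
    and g: "\<And>j. j \<ge> 2 \<Longrightarrow> 0 < g j \<and> g j < 1"
    and l_lim: "l \<longlonglongrightarrow> 0"
    and f_summable: "summable (\<lambda>j. (1 - f (j + 2)) / l (j + 2))"
    and f_sum: "(\<Sum>j. (1 - f (j + 2)) / l (j + 2)) < 1"
    and g_summable: "summable (\<lambda>j. (1 - g (j + 2)) / l (j + 2))"
    and g_sum: "(\<Sum>j. (1 - g (j + 2)) / l (j + 2)) < 1"
    and U_00: "U 0 0 = 2"
    and U_0j: "\<And>j. j \<ge> 2 \<Longrightarrow> U 0 (1 / real j) = 1 + g j"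
    and U_i0: "\<And>i. i \<ge> 2 \<Longrightarrow> U (1 / real i) 0 = 1 + f i"
    and U_ij: "\<And>i j. i \<ge> 2 \<Longrightarrow> j \<ge> 2 \<Longrightarrow>
      U (1 / real i) (1 / real j) = l i * (if i = j then 1 else 0) + 1 + f i * g j"
    and \<alpha>: "\<alpha> > 0"
    and M: "prob_space M"
    and X: "prob_space.permanental_process M \<alpha> T U X"
    and l_log: "filterlim (\<lambda>n. l n * ln (real n)) at_top sequentially"
  shows "AE \<omega> in M. limsup (\<lambda>n. ereal (X (1 / real n) \<omega> / (l n * ln (real n)))) = 1"
proof -
  interpret prob_space M by (rule M)
  note perm = X[unfolded permanental_process_def, rule_format]
  have in_T: "1 / real n \<in> T" if "n \<ge> 2" for n using that by (auto simp: T)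
  have X_meas [measurable]: "X t \<in> borel_measurable M" if "t \<in> T" for t
    using perm[of "\<lambda>_. t" 1] that by (auto simp: permanental_vector_def inj_on_def)
  have X0 [measurable]: "X 0 \<in> borel_measurable M" by (rule X_meas) (simp add: T)
  have Xn [measurable]: "X (1 / real n) \<in> borel_measurable M" if "n \<ge> 2" for n
    by (rule X_meas[OF in_T[OF that]])
  have f_sum': "summable (\<lambda>j. (1 - f j) / l j)" and g_sum': "summable (\<lambda>j. (1 - g j) / l j)"
    using f_summable g_summable summable_iff_shift[of "\<lambda>j. (1 - f j) / l j" 2]
      summable_iff_shift[of "\<lambda>j. (1 - g j) / l j" 2] by auto
  have scale_pos: "0 < l n * ln (real n)" if "n \<ge> 2" for n
    using l_pos[OF that] that by simp

  \<comment> \<open>Upper bound for the limsup\<close>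
  have upper: "AE \<omega> in M. \<forall>\<^sub>F n in sequentially. X (1 / real n) \<omega> \<le> (1 + \<epsilon>) * (l n * ln (real n))"
    if \<epsilon>: "0 < \<epsilon>" "\<epsilon> \<le> 1" for \<epsilon>
  proof -
    \<comment> \<open>Three losses of order \<delta> must fit into \<epsilon>: the Chernoff
      parameter 1 - \<delta>, the scale factor 1 + 2 * \<delta>, and the factor n^\<delta> paid for
      the weight. The exponent of 1 / n that remains is \<eta>, and a tenth of \<epsilon> keeps it
      above 1.\<close>
    define \<delta> where "\<delta> = \<epsilon> / 10"
    have \<delta>: "0 < \<delta>" "\<delta> < 1" using \<epsilon> by (auto simp: \<delta>_def)
    define \<eta> where "\<eta> = (1 - \<delta>) * ((1 + \<epsilon>) / (1 + 2 * \<delta>)) - \<delta>"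
    have "\<epsilon> * \<epsilon> \<le> \<epsilon> * 1"
      using \<epsilon> by (intro mult_left_mono) auto
    hence "1 + 2 * \<delta> < (1 - \<delta>) * (1 + \<epsilon>) - \<delta> * (1 + 2 * \<delta>)"
      using \<epsilon> by (simp add: \<delta>_def field_simps)
    hence \<eta>: "\<eta> > 1" using \<delta> by (simp add: \<eta>_def field_simps)
    define c where "c n = (1 + \<epsilon>) * (l n * ln (real n))" for n
    \<comment> \<open>The shift by 2 matters: the point 1 / 1 is not in T, so nothing is known about
      the measurability of \<open>X\<close> there.\<close>
    have "AE \<omega> in M. \<forall>\<^sub>F j in sequentially. \<omega> \<in> space M - {\<omega> \<in> space M. c (j + 2) < X (1 / real (j + 2)) \<omega> \<and> X 0 \<omega> \<le> B}"
      if B: "B \<ge> 0" for B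
    proof (rule borel_cantelli_AE1)
      let ?A = "\<lambda>j. {\<omega> \<in> space M. c (j + 2) < X (1 / real (j + 2)) \<omega> \<and> X 0 \<omega> \<le> B}"
      have [measurable]: "X (1 / real (j + 2)) \<in> borel_measurable M" for j by (rule Xn) simp
      show "?A j \<in> sets M" for j by measurable
      show "emeasure M (?A j) < \<infinity>" for j by (simp add: less_top[symmetric])
      have "\<forall>\<^sub>F n in sequentially. (1 - f n) / l n < \<delta>"
        using order_tendstoD(2)[OF summable_LIMSEQ_zero[OF f_sum'] \<delta>(1)] .
      \<comment> \<open>The growth of l n * ln n enters here: this inequality says exactly that
        \<open>s0 * B\<close>, with s0 = 1 / (\<delta> * l n), is at most \<delta> * ln n.\<close>
      moreover have "\<forall>\<^sub>F n in sequentially. B / \<delta>\<^sup>2 \<le> l n * ln (real n)"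
        using l_log by (simp add: filterlim_at_top)
      moreover have "\<forall>\<^sub>F n::nat in sequentially. n \<ge> 2"
        by (rule eventually_ge_at_top)
      ultimately have "\<forall>\<^sub>F n in sequentially. measure M {\<omega> \<in> space M. c n < X (1 / real n) \<omega> \<and> X 0 \<omega> \<le> B}
          \<le> \<delta> powr (- \<alpha>) * real n powr (- \<eta>)"
      proof eventually_elim
        case (elim n)
        note n = elim(3)
        have l: "0 < l n" by (rule l_pos[OF n])
        have lnn: "0 \<le> ln (real n)" using n by simp
        define s0 where "s0 = 1 / (\<delta> * l n)"
        have s0: "s0 > 0" "s0 * (\<delta> * l n) = 1" using \<delta> l by (auto simp: s0_def)
        define L where "L = l n + (1 + f n * g n + s0 * ((1 - f n) * (1 - g n))) / (1 + 2 * s0)"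
        have num: "0 \<le> 1 + f n * g n + s0 * ((1 - f n) * (1 - g n))"
          using f[OF n] g[OF n] s0 by simp
        have L: "0 < L" using l num s0 by (simp add: L_def add_pos_nonneg)
        \<comment> \<open>As \<open>s0\<close> grows, the fraction in \<open>L\<close> tends to (1 -
          f n) * (1 - g n) / 2 and not to 0; the bound 1 - f n \<le> \<delta> * l n makes this
          remainder small compared with \<open>l n\<close>.\<close>
        have L_le: "L \<le> l n * (1 + 2 * \<delta>)"
        proof -
          have "1 - f n \<le> \<delta> * l n" using elim(1) l by (simp add: field_simps)
          hence "(1 - f n) * (1 - g n) \<le> (\<delta> * l n) * 1"
            using f[OF n] g[OF n] \<delta> l by (intro mult_mono) auto
          hence "s0 * ((1 - f n) * (1 - g n)) \<le> s0 * (\<delta> * l n)"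
            using s0 by (intro mult_left_mono) auto
          moreover have "f n * g n \<le> 1 * 1" using f[OF n] g[OF n] by (intro mult_mono) auto
          ultimately have "1 + f n * g n + s0 * ((1 - f n) * (1 - g n)) \<le> 3" using s0 by simp
          hence "(1 + f n * g n + s0 * ((1 - f n) * (1 - g n))) / (1 + 2 * s0) \<le> 3 / (2 * s0)"
            using s0 num by (intro frac_le) auto
          also have "\<dots> = 3 / 2 * (\<delta> * l n)" using \<delta> l by (simp add: s0_def)
          also have "\<dots> \<le> 2 * (\<delta> * l n)" using \<delta> l by simp
          finally show ?thesis by (simp add: L_def algebra_simps)
        qed
        define t where "t i = (if i = 0 then 0 else 1 / real n)" for i :: nat
        have "permanental_vector \<alpha> 2 (Matrix.mat 2 2 (\<lambda>(i, j). U (t i) (t j))) (\<lambda>i. X (t i))"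
          using n by (intro perm) (auto simp: inj_on_def t_def T)
        from permanental_pair_tail_le[OF this, of "g n" "f n" "l n" s0 "c n" B]
        have "emeasure M {\<omega> \<in> space M. c n < X (1 / real n) \<omega> \<and> X 0 \<omega> \<le> B} \<le>
            ennreal (exp (s0 * B)) * emeasure (gamma_measure \<alpha> L) {c n<..}"
          using n l f[OF n] g[OF n] s0 by (simp add: t_def L_def U_00 U_0j U_i0 U_ij)
        also have "\<dots> \<le> ennreal (exp (s0 * B)) * ennreal ((1 - (1 - \<delta>)) powr (- \<alpha>) * exp (- ((1 - \<delta>) * c n / L)))"
          using \<delta> by (intro mult_left_mono gamma_measure_tail_upper[OF \<alpha> L]) auto
        also have "\<dots> = ennreal (\<delta> powr (- \<alpha>) * exp (s0 * B - (1 - \<delta>) * (c n / L)))"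
          by (simp add: ennreal_mult'[symmetric] exp_diff exp_minus divide_inverse mult_ac)
        also have "\<dots> \<le> ennreal (\<delta> powr (- \<alpha>) * real n powr (- \<eta>))"
        proof (intro ennreal_leI mult_left_mono)
          have "s0 * B = B / \<delta>\<^sup>2 * (\<delta> / l n)"
            using \<delta> l by (simp add: s0_def power2_eq_square)
          also have "\<dots> \<le> (l n * ln (real n)) * (\<delta> / l n)"
            using elim(2) \<delta> l by (intro mult_right_mono) auto
          also have "\<dots> = \<delta> * ln (real n)" using l by simp
          finally have 1: "s0 * B \<le> \<delta> * ln (real n)" .
          have "(1 + \<epsilon>) / (1 + 2 * \<delta>) * ln (real n) = c n / (l n * (1 + 2 * \<delta>))"
            using l by (simp add: c_def)
          also have "\<dots> \<le> c n / L"
            using L L_le \<epsilon> l lnn by (intro divide_left_mono) (auto simp: c_def intro!: mult_pos_pos)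
          finally have "(1 - \<delta>) * ((1 + \<epsilon>) / (1 + 2 * \<delta>) * ln (real n)) \<le> (1 - \<delta>) * (c n / L)"
            using \<delta> by (intro mult_left_mono) auto
          with 1 have "s0 * B - (1 - \<delta>) * (c n / L) \<le> - \<eta> * ln (real n)"
            by (simp add: \<eta>_def algebra_simps)
          thus "exp (s0 * B - (1 - \<delta>) * (c n / L)) \<le> real n powr (- \<eta>)"
            using n by (simp add: powr_def)
        qed simp
        finally show ?case by (simp add: emeasure_eq_measure)
      qed
      from eventually_compose_filterlim[OF this filterlim_add_const_nat_at_top[of 2]]
      have "\<forall>\<^sub>F j in sequentially. norm (measure M (?A j)) \<le> \<delta> powr (- \<alpha>) * real (j + 2) powr (- \<eta>)"
        by (simp only: real_norm_def abs_of_nonneg measure_nonneg)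
      moreover have "summable (\<lambda>j. \<delta> powr (- \<alpha>) * real (j + 2) powr (- \<eta>))"
        using \<eta> summable_real_powr_iff[of "- \<eta>"] summable_iff_shift[of "\<lambda>j. real j powr (- \<eta>)" 2]
        by (intro summable_mult) auto
      ultimately show "summable (\<lambda>j. measure M (?A j))"
        by (rule summable_comparison_test_ev)
    qed
    \<comment> \<open>Every \<omega> satisfies X 0 \<omega> \<le> B for some natural number
      \<open>B\<close>, so countably many levels suffice.\<close>
    hence "AE \<omega> in M. \<forall>B::nat. \<forall>\<^sub>F j in sequentially.
        \<omega> \<in> space M - {\<omega> \<in> space M. c (j + 2) < X (1 / real (j + 2)) \<omega> \<and> X 0 \<omega> \<le> real B}"
      by (subst AE_all_countable) simp
    thus ?thesis
    proof eventually_elim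
      case (elim \<omega>)
      obtain B :: nat where B: "X 0 \<omega> \<le> real B" using real_arch_simple by blast
      have "\<forall>\<^sub>F j in sequentially. X (1 / real (j + 2)) \<omega> \<le> c (j + 2)"
        using elim[rule_format, of B] by eventually_elim (use B in auto)
      thus ?case
        using eventually_sequentially_seg[of "\<lambda>n. X (1 / real n) \<omega> \<le> c n" 2] by (simp add: c_def)
    qed
  qed

  \<comment> \<open>Lower bound for the limsup\<close>
  have lower: "AE \<omega> in M. \<exists>\<^sub>F n in sequentially. (1 - \<epsilon>) * (l n * ln (real n)) < X (1 / real n) \<omega>"
    if \<epsilon>: "0 < \<epsilon>" "\<epsilon> < 1" for \<epsilon>
  proof -
    define x where "x n = l n * ((1 - \<epsilon>) * ln (real n))" for n
    \<comment> \<open>Both factors tend to 0, so g n tends to 1 and is eventually at least 1/2, as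
      the basis used for the power series requires.\<close>
    have "(\<lambda>n. (1 - g n) / l n * l n) \<longlonglongrightarrow> 0 * 0"
      by (intro tendsto_mult summable_LIMSEQ_zero[OF g_sum'] l_lim)
    hence "\<forall>\<^sub>F n in sequentially. (1 - g n) / l n * l n < 1 / 2"
      by (intro order_tendstoD(2)) auto
    moreover have "\<forall>\<^sub>F n in sequentially. \<forall>L>0.
       emeasure (gamma_measure \<alpha> L) {..L * ((1 - \<epsilon>) * ln (real n))} \<le> ennreal (1 - 1 / real n)"
      by (rule eventually_gamma_measure_atMost_le[OF \<alpha> \<epsilon>])
    moreover have "\<forall>\<^sub>F N in sequentially. \<forall>m. (\<Sum>i<m. (1 - f (N + i)) / l (N + i)) \<le> 1 / 10"
      by (rule summable_tail_sum_le[OF f_sum', where K = 2]) (use f l_pos in \<open>auto simp: less_imp_le\<close>)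
    moreover have "\<forall>\<^sub>F N in sequentially. \<forall>m. (\<Sum>i<m. (1 - g (N + i)) / l (N + i)) \<le> 1 / 10"
      by (rule summable_tail_sum_le[OF g_sum', where K = 2]) (use g l_pos in \<open>auto simp: less_imp_le\<close>)
    moreover note eventually_ge_at_top[of "2::nat"]
    moreover define good where "good n \<longleftrightarrow> (1 - g n) / l n * l n < 1 / 2 \<and>
        (\<forall>L>0. emeasure (gamma_measure \<alpha> L) {..L * ((1 - \<epsilon>) * ln (real n))} \<le> ennreal (1 - 1 / real n)) \<and>
        (\<forall>m. (\<Sum>i<m. (1 - f (n + i)) / l (n + i)) \<le> 1 / 10) \<and>
        (\<forall>m. (\<Sum>i<m. (1 - g (n + i)) / l (n + i)) \<le> 1 / 10) \<and> 2 \<le> n" for n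
    ultimately have "\<forall>\<^sub>F n in sequentially. good n"
      unfolding good_def by (intro eventually_conj)
    then obtain N0 where good: "\<And>n. n \<ge> N0 \<Longrightarrow> good n"
      unfolding eventually_sequentially by blast
    have N0: "2 \<le> n" "(1 - g n) / l n * l n < 1 / 2"
      "\<And>L. L > 0 \<Longrightarrow> emeasure (gamma_measure \<alpha> L) {..L * ((1 - \<epsilon>) * ln (real n))} \<le> ennreal (1 - 1 / real n)"
      "\<And>m. (\<Sum>i<m. (1 - f (n + i)) / l (n + i)) \<le> 1 / 10"
      "\<And>m. (\<Sum>i<m. (1 - g (n + i)) / l (n + i)) \<le> 1 / 10" if "n \<ge> N0" for n
      using good[OF that] unfolding good_def by blast+
    have g_half: "1 / 2 \<le> g n" if "n \<ge> N0" for n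
      using N0(1,2)[OF that] l_pos[of n] by simp
    have "AE \<omega> in M. \<exists>n\<ge>N. x n < X (1 / real n) \<omega>" if N: "N \<ge> N0" for N
    proof -
      have N2: "2 \<le> N" by (rule N0(1)[OF N])
      have le: "emeasure M {\<omega> \<in> space M. \<forall>i<m. X (1 / real (N + i)) \<omega> \<le> x (N + i)} \<le>
          ennreal ((real N - 1) / (real N + real m - 1))" for m
      proof -
        define t where "t i = 1 / real (N + i)" for i
        have "permanental_vector \<alpha> m (Matrix.mat m m (\<lambda>(i, j). U (t i) (t j))) (\<lambda>i. X (t i))"
          using N2 by (intro perm) (auto simp: inj_on_def t_def intro!: in_T simp del: of_nat_add)
        hence "emeasure M {\<omega> \<in> space M. \<forall>i<m. X (t i) \<omega> \<le> x (N + i)} \<le>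
            (\<Prod>i<m. emeasure (gamma_measure \<alpha> (l (N + i))) {..x (N + i)})"
        proof (rule permanental_joint_cdf_le[where f = "\<lambda>i. f (N + i)" and g = "\<lambda>i. g (N + i)"])
          show "f (N + i) \<in> {0..1}" for i using f[of "N + i"] N2 by auto
          show "g (N + i) \<in> {1/2..1}" for i using g[of "N + i"] g_half[of "N + i"] N N2 by auto
        qed (use N2 N0(4,5)[OF N] l_pos in \<open>auto simp: t_def U_ij simp del: of_nat_add\<close>)
        also have "\<dots> \<le> (\<Prod>i<m. ennreal (1 - 1 / real (N + i)))"
          using N N2 N0(3) l_pos by (intro prod_mono_ennreal) (auto simp: x_def simp del: of_nat_add)
        also have "\<dots> = ennreal (\<Prod>i<m. 1 - 1 / real (N + i))"
          using N2 by (intro prod_ennreal) auto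
        finally show ?thesis unfolding prod_one_minus_inverse[OF N2] t_def .
      qed
      have [measurable]: "X (1 / real (N + i)) \<in> borel_measurable M" for i
        using N2 by (intro Xn) simp
      define E where "E = {\<omega> \<in> space M. \<forall>i. X (1 / real (N + i)) \<omega> \<le> x (N + i)}"
      have [measurable]: "E \<in> sets M" unfolding E_def by measurable
      have [measurable]: "{\<omega> \<in> space M. \<forall>i<m. X (1 / real (N + i)) \<omega> \<le> x (N + i)} \<in> sets M" for m
        by measurable
      have bound: "emeasure M E \<le> ennreal ((real N - 1) / (real N + real m - 1))" for m
      proof -
        have "E \<subseteq> {\<omega> \<in> space M. \<forall>i<m. X (1 / real (N + i)) \<omega> \<le> x (N + i)}"
          unfolding E_def by blast
        hence "emeasure M E \<le> emeasure M {\<omega> \<in> space M. \<forall>i<m. X (1 / real (N + i)) \<omega> \<le> x (N + i)}"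
          by (rule emeasure_mono) measurable
        also have "\<dots> \<le> ennreal ((real N - 1) / (real N + real m - 1))" by (rule le)
        finally show ?thesis .
      qed
      have lim: "(\<lambda>m. ennreal ((real N - 1) / (real N + real m - 1))) \<longlonglongrightarrow> ennreal 0"
        by (intro tendsto_ennrealI) real_asymp
      have "emeasure M E \<le> ennreal 0" by (rule LIMSEQ_le_const[OF lim]) (use bound in blast)
      hence "E \<in> null_sets M" by auto
      thus ?thesis
        by (rule AE_I') (auto simp: E_def not_less simp del: of_nat_add)
    qed
    hence "AE \<omega> in M. \<forall>N. N0 \<le> N \<longrightarrow> (\<exists>n\<ge>N. x n < X (1 / real n) \<omega>)"
      by (subst AE_all_countable) auto
    thus ?thesis
    proof eventually_elim
      case (elim \<omega>)
      have "\<exists>n\<ge>N. x n < X (1 / real n) \<omega>" for N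
        using elim[rule_format, of "max N N0"] by auto
      thus ?case unfolding frequently_sequentially by (simp add: x_def mult_ac)
    qed
  qed

  \<comment> \<open>The values 1 / (k + 1) lie in the range \<epsilon> \<le> 1 of the upper bound;
    the lower bound asks for \<epsilon> < 1, hence 1 / (k + 2) there.\<close>
  have "AE \<omega> in M. \<forall>k::nat. \<forall>\<^sub>F n in sequentially. X (1 / real n) \<omega> \<le> (1 + 1 / real (k + 1)) * (l n * ln (real n))"
    by (subst AE_all_countable) (intro allI upper, auto)
  moreover have "AE \<omega> in M. \<forall>k::nat. \<exists>\<^sub>F n in sequentially. (1 - 1 / real (k + 2)) * (l n * ln (real n)) < X (1 / real n) \<omega>"
    by (subst AE_all_countable) (intro allI lower, auto)
  ultimately show ?thesis
  proof eventually_elim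
    case (elim \<omega>)
    \<comment> \<open>The denominators are known to be positive only from n = 2 on; a limsup ignores
      the earlier terms, and each comparison below is restricted accordingly.\<close>
    define Y where "Y n = ereal (X (1 / real n) \<omega> / (l n * ln (real n)))" for n
    have le: "limsup Y \<le> ereal (1 + 1 / real (k + 1))" for k :: nat
    proof (rule Limsup_bounded)
      show "\<forall>\<^sub>F n in sequentially. Y n \<le> ereal (1 + 1 / real (k + 1))"
        using elim(1)[rule_format, of k] eventually_ge_at_top[of "2::nat"]
      proof eventually_elim
        case (elim n)
        thus ?case using scale_pos[of n] by (simp add: Y_def divide_le_eq)
      qed
    qed
    have "(\<lambda>k. ereal (1 + 1 / real (k + 1))) \<longlonglongrightarrow> ereal 1"
      by (intro tendsto_ereal) real_asymp
    hence "limsup Y \<le> ereal 1" by (rule LIMSEQ_le_const) (use le in blast)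
    have ge: "ereal (1 - 1 / real (k + 2)) \<le> limsup Y" for k :: nat
    proof (rule ccontr)
      assume "\<not> ereal (1 - 1 / real (k + 2)) \<le> limsup Y"
      hence "\<forall>\<^sub>F n in sequentially. Y n < ereal (1 - 1 / real (k + 2))"
        by (intro Limsup_lessD) auto
      moreover have "\<forall>\<^sub>F n::nat in sequentially. n \<ge> 2"
        by (rule eventually_ge_at_top)
      ultimately have "\<forall>\<^sub>F n in sequentially. \<not> (1 - 1 / real (k + 2)) * (l n * ln (real n)) < X (1 / real n) \<omega>"
      proof eventually_elim
        case (elim n)
        thus ?case using scale_pos[of n] by (simp add: Y_def divide_less_eq)
      qed
      thus False using elim(2)[rule_format, of k] by (simp add: frequently_def)
    qed
    have "(\<lambda>k. ereal (1 - 1 / real (k + 2))) \<longlonglongrightarrow> ereal 1"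
      by (intro tendsto_ereal) real_asymp
    hence "ereal 1 \<le> limsup Y" by (rule LIMSEQ_le_const2) (use ge in blast)
    with \<open>limsup Y \<le> ereal 1\<close> have "limsup Y = 1" by simp
    thus ?case unfolding Y_def .
  qed
qed

end
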